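(* Let $1\le s\le n$ and $k \geq \ell \geq 2$ be integers, and let $G={n \brack s}_{q}$ denote the number of $s$-dimensional subspaces of $\mathbb{F}_q^n$. Then $$\left\lfloor \frac{k-1}{\ell-1}\right\rfloor G\leq \Omega_{s,n}^{(k,\ell)}\leq \left\lfloor\frac{k-1}{\ell-1}\cdot G\right\rfloor;$$ more precisely, $$\Omega^{(k,\ell)}_{s,n}=\max\left\{\sum_{i=1}^{G}t_i\;\middle|\; t_1,\dots,t_G\in\mathbb{Z}_{\ge0},\ \sum_{i \in I}t_i \leq k-1\ \text{for all } I \subseteq [G] \text{ with } |I|=\ell-1\right\}.$$ As a consequence, if $\ell-1$ divides $k-1$, then $\Omega_{s,n}^{(k,\ell)}=\frac{k-1}{\ell-1}\cdot G$; in particular $\Omega_{s,n}^{(k,2)}=(k-1)G$.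
   Context: Let $\mathcal{K}$ be a field with a discrete valuation $\nu:\mathcal{K}\to\mathbb{Z}\cup\{\infty\}$, valuation ring $\mathcal{O}$, maximal ideal $\mathfrak{m}$, and finite residue field $\mathcal{O}/\mathfrak{m}\cong\mathbb{F}_q$. Put $|\lambda|=q^{-\nu(\lambda)}$ and $\|\mathbf{v}\|=\max_{i}|v_i|$ on $\mathcal{K}^n$. Vectors $\mathbf{u},\mathbf{v}\in\mathcal{K}^n$ are orthogonal if $\|a\mathbf{u}+b\mathbf{v}\|=\max(\|a\mathbf{u}\|,\|b\mathbf{v}\|)$ for all $a,b\in\mathcal{K}$; subspaces $U,V$ are orthogonal if every $\mathbf u\in U$ and $\mathbf v\in V$ are orthogonal. Two subspaces $U,V\le\mathcal{K}^n$ are feebly orthogonal if either there is $\mathbf{u}\in U\setminus\{\mathbf 0\}$ with $\mathcal{K}\mathbf{u}$ and $V$ orthogonal, or there is $\mathbf{v}\in V\setminus\{\mathbf 0\}$ with $\mathcal{K}\mathbf{v}$ and $U$ orthogonal. ${\rm Gr}_{s,n}(\mathcal{K})$ is the set of $s$-dimensional subspaces of $\mathcal{K}^n$. A family $\mathcal{F}\subseteq{\rm Gr}_{s,n}(\mathcal{K})$ is $(k,\ell)$-feebly orthogonal if every $\mathcal{E}\subseteq\mathcal{F}$ of size $k$ contains a subfamily of size $\ell$ whose distinct members are pairwise feebly orthogonal. $\Omega_{s,n}^{(k,\ell)}$ is the maximum size of a $(k,\ell)$-feebly orthogonal family in ${\rm Gr}_{s,n}(\mathcal{K})$.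
   Formalization: The upper bound, max formula and divisibility consequence are proved for l-1 ≤ G (they fail for l-1 > G, where Omega = k-1 if s < n); for s = n, where Gr has one element and Omega = 1, the result is proved for families with repeated members instead of sets. *)

theory Defs
  imports "HOL-Analysis.Analysis" "HOL-Algebra.Algebraic_Closure_Type"
    "HOL-Library.Extended" "HOL-Library.Multiset"
begin

(* The type int extended also contains Minf (minus infinity), which a valuation never takes.
   Discreteness is nontriviality of the integer-valued nu; the normalisation that nu is onto the
   integers is not imposed, so both conventions in use are covered. *)
definition discrete_valuation :: "('k::field \<Rightarrow> int extended) \<Rightarrow> bool" where
  "discrete_valuation \<nu> \<longleftrightarrow>
     (\<forall>x. \<nu> x \<noteq> Minf) \<and>
     (\<forall>x. \<nu> x = Pinf \<longleftrightarrow> x = 0) \<and>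
     (\<forall>x y. \<nu> (x * y) = \<nu> x + \<nu> y) \<and>
     (\<forall>x y. min (\<nu> x) (\<nu> y) \<le> \<nu> (x + y)) \<and>
     (\<exists>x. x \<noteq> 0 \<and> \<nu> x \<noteq> 0)"

definition valuation_ring :: "('k::field \<Rightarrow> int extended) \<Rightarrow> 'k ring" where
  "valuation_ring \<nu> = ring_of_type_algebra\<lparr>carrier := {x. 0 \<le> \<nu> x}\<rparr>"

definition maximal_ideal :: "('k::field \<Rightarrow> int extended) \<Rightarrow> 'k set" where
  "maximal_ideal \<nu> = {x. 0 < \<nu> x}"

definition residue_field :: "('k::field \<Rightarrow> int extended) \<Rightarrow> 'k set ring" where
  "residue_field \<nu> = valuation_ring \<nu> Quot maximal_ideal \<nu>"

definition vabs :: "('k::field \<Rightarrow> int extended) \<Rightarrow> 'k \<Rightarrow> real" where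
  "vabs \<nu> x =
     (case \<nu> x of Fin m \<Rightarrow> real (card (carrier (residue_field \<nu>))) powi (- m) | _ \<Rightarrow> 0)"

definition vnorm :: "('k::field \<Rightarrow> int extended) \<Rightarrow> 'k ^ 'n \<Rightarrow> real" where
  "vnorm \<nu> v = Max (range (\<lambda>i. vabs \<nu> (v $ i)))"

definition orth_vec :: "('k::field \<Rightarrow> int extended) \<Rightarrow> 'k ^ 'n \<Rightarrow> 'k ^ 'n \<Rightarrow> bool" where
  "orth_vec \<nu> u v \<longleftrightarrow>
     (\<forall>a b. vnorm \<nu> (a *s u + b *s v) = max (vnorm \<nu> (a *s u)) (vnorm \<nu> (b *s v)))"

definition orth :: "('k::field \<Rightarrow> int extended) \<Rightarrow> ('k ^ 'n) set \<Rightarrow> ('k ^ 'n) set \<Rightarrow> bool" where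
  "orth \<nu> U V \<longleftrightarrow> (\<forall>u\<in>U. \<forall>v\<in>V. orth_vec \<nu> u v)"

definition feebly_orth ::
    "('k::field \<Rightarrow> int extended) \<Rightarrow> ('k ^ 'n) set \<Rightarrow> ('k ^ 'n) set \<Rightarrow> bool" where
  "feebly_orth \<nu> U V \<longleftrightarrow>
     (\<exists>u\<in>U - {0}. orth \<nu> (vec.span {u}) V) \<or> (\<exists>v\<in>V - {0}. orth \<nu> (vec.span {v}) U)"

definition Gr :: "nat \<Rightarrow> ('a::field ^ 'n) set set" where
  "Gr s = {U. vec.subspace U \<and> vec.dim U = s}"

definition feebly_orth_family ::
    "('k::field \<Rightarrow> int extended) \<Rightarrow> nat \<Rightarrow> nat \<Rightarrow> nat \<Rightarrow> ('k ^ 'n) set set \<Rightarrow> bool" where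
  "feebly_orth_family \<nu> s k l F \<longleftrightarrow>
     F \<subseteq> Gr s \<and>
     (\<forall>E\<subseteq>F. finite E \<and> card E = k \<longrightarrow>
        (\<exists>D\<subseteq>E. card D = l \<and> pairwise (feebly_orth \<nu>) D))"

(* The same notion for families in which a subspace may occur repeatedly. Two copies of one
   subspace count as distinct members (and are never feebly orthogonal). *)
definition feebly_orth_multifamily ::
    "('k::field \<Rightarrow> int extended) \<Rightarrow> nat \<Rightarrow> nat \<Rightarrow> nat \<Rightarrow> ('k ^ 'n) set multiset \<Rightarrow> bool" where
  "feebly_orth_multifamily \<nu> s k l F \<longleftrightarrow>
     set_mset F \<subseteq> Gr s \<and>
     (\<forall>E. E \<subseteq># F \<and> size E = k \<longrightarrow>
        (\<exists>D. D \<subseteq># E \<and> size D = l \<and> (\<forall>U V. {#U, V#} \<subseteq># D \<longrightarrow> feebly_orth \<nu> U V)))"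

definition is_maximum :: "'a::order set \<Rightarrow> 'a \<Rightarrow> bool" where
  "is_maximum S m \<longleftrightarrow> m \<in> S \<and> (\<forall>x\<in>S. x \<le> m)"

(* is_Omega TYPE('n) nu s k l N says that the maximum defining Omega exists and equals N.
   The finiteness clause is needed because card is 0 on infinite sets. *)
definition is_Omega ::
    "'n::finite itself \<Rightarrow> ('k::field \<Rightarrow> int extended) \<Rightarrow> nat \<Rightarrow> nat \<Rightarrow> nat \<Rightarrow> nat \<Rightarrow> bool" where
  "is_Omega _ \<nu> s k l N \<longleftrightarrow>
     (\<forall>F :: ('k ^ 'n) set set. feebly_orth_family \<nu> s k l F \<longrightarrow> finite F) \<and>
     is_maximum {card F | F :: ('k ^ 'n) set set. feebly_orth_family \<nu> s k l F} N"

definition is_Omega_multi ::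
    "'n::finite itself \<Rightarrow> ('k::field \<Rightarrow> int extended) \<Rightarrow> nat \<Rightarrow> nat \<Rightarrow> nat \<Rightarrow> nat \<Rightarrow> bool" where
  "is_Omega_multi _ \<nu> s k l N \<longleftrightarrow>
     is_maximum {size F | F :: ('k ^ 'n) set multiset. feebly_orth_multifamily \<nu> s k l F} N"

end

(* A subspace U of K^n has a reduction Red U, the image in F_q^n of the integral vectors of U, of the
   same dimension. A line Ku with ||u|| = 1 is orthogonal to V iff the reduction of u is not in Red V,
   so two subspaces of equal dimension are feebly orthogonal iff their reductions differ. Hence a
   family is (k,l)-feebly orthogonal iff any l-1 fibres of Red contain together at most k-1 of its
   members. All G fibres are nonempty, and infinite for s < n, so their multiplicities t_i are subject
   to no other constraint. *)
theory Submission
  imports Defs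
begin

section \<open>Separated multisets\<close>

text \<open>The criterion sees a family only through the multiset of its reductions. This separates
  an extremal problem for multisets T over the finite set Y = Gr s of F_q^n, with
  \<open>admissible\<close> as the constraint, from the question which T occur. Families and
  multifamilies obey the same constraint and differ only in the second point: repetition realises
  every T, whereas distinct subspaces need large fibres. Quantifying over
  \<open>card I \<le> m\<close> instead of \<open>card I = m\<close> keeps the constraint correct
  when Y has fewer than m points. On the valuation side the difficulty is dimension, since an
  arbitrary basis of U need not reduce to independent vectors. Bases are therefore lifted instead: a
  linear relation over K, divided by its coefficient of largest absolute value, reduces to a
  nontrivial relation over F_q.\<close>

definition admissible :: "'x set \<Rightarrow> nat \<Rightarrow> nat \<Rightarrow> 'x multiset \<Rightarrow> bool" where
  "admissible Y r m T \<longleftrightarrow>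
     set_mset T \<subseteq> Y \<and> (\<forall>I\<subseteq>Y. card I \<le> m \<longrightarrow> size (filter_mset (\<lambda>x. x \<in> I) T) \<le> r)"

lemma ex_submultiset_of_size:
  "n \<le> size M \<Longrightarrow> \<exists>E. E \<subseteq># M \<and> size E = n"
proof -
  assume n: "n \<le> size M"
  obtain xs where "M = mset xs" by (metis ex_mset)
  moreover have "mset (take n xs) \<subseteq># mset xs"
    by (metis append_take_drop_id mset_append mset_subset_eq_add_left)
  ultimately show ?thesis using n by (intro exI[of _ "mset (take n xs)"]) auto
qed

lemma pair_submultiset_iff:
  "{#U, V#} \<subseteq># D \<longleftrightarrow> (if U = V then 2 \<le> count D U else U \<in># D \<and> V \<in># D)"
  by (auto simp: subseteq_mset_def count_greater_zero_iff[symmetric] Suc_le_eq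
      simp del: count_greater_zero_iff)

lemma pair_submultiset_mset_set_iff:
  "finite A \<Longrightarrow> {#U, V#} \<subseteq># mset_set A \<longleftrightarrow> U \<noteq> V \<and> U \<in> A \<and> V \<in> A"
  by (simp add: pair_submultiset_iff count_mset_set')

lemma mset_set_eq_if_count_le_1:
  assumes "\<And>x. count D x \<le> 1"
  shows "mset_set (set_mset D) = D"
proof (rule multiset_eqI)
  fix x
  show "count (mset_set (set_mset D)) x = count D x"
    using assms[of x] by (cases "x \<in># D") (auto simp: count_mset_set' le_Suc_eq dest: count_inI simp flip: not_in_iff)
qed

text \<open>Since R fails on equal values of f, l pairwise related members amount to l distinct
  values. So the left side fails exactly when some k members of M have at most l - 1 values between
  them.\<close>

lemma pairwise_separated_iff_admissible:
  assumes Y: "finite Y" "f ` S \<subseteq> Y"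
    and R: "\<And>U V. U \<in> S \<Longrightarrow> V \<in> S \<Longrightarrow> R U V \<longleftrightarrow> f U \<noteq> f V"
    and M: "set_mset M \<subseteq> S" and kl: "1 \<le> l" "l \<le> k"
  shows "(\<forall>E. E \<subseteq># M \<and> size E = k \<longrightarrow>
        (\<exists>D. D \<subseteq># E \<and> size D = l \<and> (\<forall>U V. {#U, V#} \<subseteq># D \<longrightarrow> R U V))) \<longleftrightarrow>
     admissible Y (k - 1) (l - 1) (image_mset f M)" (is "?L \<longleftrightarrow> ?R")
proof
  assume L: ?L
  show ?R unfolding admissible_def
  proof (intro conjI allI impI)
    show "set_mset (image_mset f M) \<subseteq> Y" using M Y by auto
    fix I assume I: "I \<subseteq> Y" "card I \<le> l - 1"
    have "finite I" using I Y finite_subset by blast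
    show "size (filter_mset (\<lambda>x. x \<in> I) (image_mset f M)) \<le> k - 1"
    proof (rule ccontr)
      assume "\<not> ?thesis"
      then have "k \<le> size (filter_mset (\<lambda>U. f U \<in> I) M)"
        by (simp add: filter_mset_image_mset)
      then obtain E where E: "E \<subseteq># (filter_mset (\<lambda>U. f U \<in> I) M)" "size E = k"
        using ex_submultiset_of_size by blast
      then have "E \<subseteq># M"
        using multiset_filter_subset subset_mset.order_trans by blast
      with L E obtain D where D: "D \<subseteq># E" "size D = l" "\<And>U V. {#U, V#} \<subseteq># D \<Longrightarrow> R U V" by blast
      have DI: "U \<in> S \<and> f U \<in> I" if "U \<in># D" for U
        using that D(1) E(1) M by (auto dest!: mset_subset_eqD)
      \<comment> \<open>A repeated U would give the pair \<open>{#U, U#}\<close> and hence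
        \<open>R U U\<close>, although \<open>f U = f U\<close>.\<close>
      have "count D U \<le> 1" for U
      proof (rule ccontr)
        assume "\<not> ?thesis"
        then have "{#U, U#} \<subseteq># D" "U \<in># D"
          by (auto simp: pair_submultiset_iff intro: count_inI)
        then show False using D(3) DI R by blast
      qed
      then have "mset_set (set_mset D) = D" by (rule mset_set_eq_if_count_le_1)
      then have "card (set_mset D) = l" using D(2) by (metis size_mset_set)
      moreover have "inj_on f (set_mset D)"
      proof (intro inj_onI, rule ccontr)
        fix U V assume UV: "U \<in># D" "V \<in># D" "f U = f V" "U \<noteq> V"
        then have "R U V" using D(3) by (simp add: pair_submultiset_iff)
        then show False using UV DI R by blast
      qed
      ultimately have "card (f ` set_mset D) = l" by (simp add: card_image)
      moreover have "f ` set_mset D \<subseteq> I" using DI by auto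
      ultimately have "l \<le> card I" using \<open>finite I\<close> card_mono by metis
      then show False using I kl by simp
    qed
  qed
next
  assume A: ?R
  show ?L
  proof (intro allI impI, elim conjE)
    fix E assume E: "E \<subseteq># M" "size E = k"
    have ES: "set_mset E \<subseteq> S" using E(1) M by (meson order_trans set_mset_mono)
    \<comment> \<open>Otherwise the values of E form a set I with at most l - 1 points, and all k
      members of E lie over it.\<close>
    have "l \<le> card (f ` set_mset E)"
    proof (rule ccontr)
      assume "\<not> ?thesis"
      then have "card (f ` set_mset E) \<le> l - 1" by simp
      moreover have "f ` set_mset E \<subseteq> Y" using ES Y by blast
      ultimately have "size (filter_mset (\<lambda>x. x \<in> f ` set_mset E) (image_mset f M)) \<le> k - 1"
        using A unfolding admissible_def by blast
      moreover have "E \<subseteq># (filter_mset (\<lambda>U. f U \<in> f ` set_mset E) M)"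
      proof -
        have "filter_mset (\<lambda>U. f U \<in> f ` set_mset E) E = E" by (auto simp: filter_mset_eq_conv)
        then show ?thesis using multiset_filter_mono[OF E(1)] by metis
      qed
      then have "k \<le> size (filter_mset (\<lambda>U. f U \<in> f ` set_mset E) M)" using E(2) size_mset_mono by blast
      ultimately show False using kl by (simp add: filter_mset_image_mset)
    qed
    then obtain J where J: "J \<subseteq> f ` set_mset E" "card J = l" "finite J"
      by (meson obtain_subset_with_card_n)
    \<comment> \<open>g selects one member of E over each of l values, so no member is selected
      twice.\<close>
    define g where "g = inv_into (set_mset E) f"
    have fg: "f (g y) = y" "g y \<in># E" if "y \<in> J" for y
      using that J(1) by (auto simp: g_def f_inv_into_f inv_into_into dest!: subsetD)
    have inj: "inj_on g J" using fg(1) by (metis inj_onI)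
    let ?D = "mset_set (g ` J)"
    have "?D \<subseteq># E"
    proof -
      have "g ` J \<subseteq> set_mset E" using fg(2) by blast
      then have "?D \<subseteq># mset_set (set_mset E)" by (simp add: subset_imp_msubset_mset_set)
      then show ?thesis using mset_set_set_mset_msubset subset_mset.order_trans by blast
    qed
    moreover have "size ?D = l" using inj J by (simp add: card_image)
    moreover have "R U V" if UV: "{#U, V#} \<subseteq># ?D" for U V
    proof -
      obtain x y where "x \<in> J" "y \<in> J" "U = g x" "V = g y" "x \<noteq> y"
        using UV J(3) by (auto simp: pair_submultiset_mset_set_iff)
      then show ?thesis using fg ES R by (metis subsetD)
    qed
    ultimately show "\<exists>D. D \<subseteq># E \<and> size D = l \<and> (\<forall>U V. {#U, V#} \<subseteq># D \<longrightarrow> R U V)" by blast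
  qed
qed

lemma submultiset_mset_set_iff:
  assumes "finite F"
  shows "E \<subseteq># mset_set F \<longleftrightarrow> (\<exists>A\<subseteq>F. E = mset_set A)"
proof
  assume E: "E \<subseteq># mset_set F"
  have "count E x \<le> 1" for x
    using E assms mset_subset_eq_count[OF E, of x] by (auto simp: count_mset_set' split: if_splits)
  then have "E = mset_set (set_mset E)" by (simp add: mset_set_eq_if_count_le_1)
  moreover have "set_mset E \<subseteq> F" using E assms by (metis finite_set_mset_mset_set set_mset_mono)
  ultimately show "\<exists>A\<subseteq>F. E = mset_set A" by blast
qed (use assms in \<open>auto intro: subset_imp_msubset_mset_set\<close>)

text \<open>A pair \<open>{#U, V#}\<close> inside some \<open>mset_set A\<close> has U and V
  distinct, which is the distinctness in \<open>pairwise\<close>. The criterion thus need only be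
  proved for multisets.\<close>

lemma feebly_orth_family_iff_multifamily:
  assumes fin: "finite F"
  shows "feebly_orth_family \<nu> s k l F \<longleftrightarrow> feebly_orth_multifamily \<nu> s k l (mset_set F)"
proof -
  have pw: "pairwise R D \<longleftrightarrow> (\<forall>U V. {#U, V#} \<subseteq># mset_set D \<longrightarrow> R U V)"
    if "finite D" for D and R :: "'x \<Rightarrow> 'x \<Rightarrow> bool"
    using that by (auto simp: pairwise_def pair_submultiset_mset_set_iff)
  have iff: "(\<exists>D. D \<subseteq># mset_set E \<and> size D = l \<and> (\<forall>U V. {#U, V#} \<subseteq># D \<longrightarrow> feebly_orth \<nu> U V)) \<longleftrightarrow>
       (\<exists>D\<subseteq>E. card D = l \<and> pairwise (feebly_orth \<nu>) D)" if "finite E" for E :: "('a ^ 'b) set set"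
  proof -
    have "pairwise (feebly_orth \<nu>) D \<longleftrightarrow> (\<forall>U V. {#U, V#} \<subseteq># mset_set D \<longrightarrow> feebly_orth \<nu> U V)"
      if "D \<subseteq> E" for D
      using pw finite_subset[OF that \<open>finite E\<close>] by blast
    moreover have "(\<exists>D. (\<exists>A\<subseteq>E. D = mset_set A) \<and> size D = l \<and> P D) \<longleftrightarrow>
        (\<exists>A\<subseteq>E. card A = l \<and> P (mset_set A))" for P
      by (metis size_mset_set)
    ultimately show ?thesis unfolding submultiset_mset_set_iff[OF that] by auto
  qed
  have "(\<forall>E\<subseteq>F. finite E \<and> card E = k \<longrightarrow> (\<exists>D\<subseteq>E. card D = l \<and> pairwise (feebly_orth \<nu>) D)) \<longleftrightarrow>
      (\<forall>E\<subseteq>F. size (mset_set E) = k \<longrightarrow> (\<exists>D. D \<subseteq># mset_set E \<and> size D = l \<and>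
        (\<forall>U V. {#U, V#} \<subseteq># D \<longrightarrow> feebly_orth \<nu> U V)))"
  proof (rule all_cong)
    fix E assume "E \<subseteq> F"
    then have "finite E" using fin finite_subset by blast
    from iff[OF this] this
    show "(finite E \<and> card E = k \<longrightarrow> (\<exists>D\<subseteq>E. card D = l \<and> pairwise (feebly_orth \<nu>) D)) \<longleftrightarrow>
      (size (mset_set E) = k \<longrightarrow> (\<exists>D. D \<subseteq># mset_set E \<and> size D = l \<and>
        (\<forall>U V. {#U, V#} \<subseteq># D \<longrightarrow> feebly_orth \<nu> U V)))" by simp
  qed
  moreover have "(\<forall>E. E \<subseteq># mset_set F \<and> Q E \<longrightarrow> P E) \<longleftrightarrow>
      (\<forall>E\<subseteq>F. Q (mset_set E) \<longrightarrow> P (mset_set E))" for P Q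
    unfolding submultiset_mset_set_iff[OF fin] by blast
  ultimately show ?thesis
    unfolding feebly_orth_family_def feebly_orth_multifamily_def finite_set_mset_mset_set[OF fin]
    by simp
qed

lemma feebly_orth_family_subset:
  assumes "feebly_orth_family \<nu> s k l F" "F' \<subseteq> F"
  shows "feebly_orth_family \<nu> s k l F'"
  unfolding feebly_orth_family_def
proof (intro conjI allI impI)
  show "F' \<subseteq> Gr s" using assms by (auto simp: feebly_orth_family_def)
  fix E assume "E \<subseteq> F'" "finite E \<and> card E = k"
  then show "\<exists>D\<subseteq>E. card D = l \<and> pairwise (feebly_orth \<nu>) D"
    using assms order_trans[of E F' F] unfolding feebly_orth_family_def by blast
qed

section \<open>The extremal problem for admissible multisets\<close>

lemma size_filter_mset_eq_sum_count:
  assumes "finite I"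
  shows "size (filter_mset (\<lambda>x. x \<in> I) T) = (\<Sum>x\<in>I. count T x)"
proof -
  have "size (filter_mset (\<lambda>x. x \<in> I) T) = (\<Sum>x\<in>set_mset (filter_mset (\<lambda>x. x \<in> I) T). count T x)"
    unfolding size_multiset_overloaded_eq by (intro sum.cong) auto
  also have "\<dots> = (\<Sum>x\<in>I. count T x)"
    using assms by (intro sum.mono_neutral_left) (auto simp: not_in_iff)
  finally show ?thesis .
qed

text \<open>One-point sets I already bound each multiplicity by r. This crude estimate makes maxima
  exist and families finite.\<close>

lemma admissible_size_le:
  assumes "finite Y" "1 \<le> m" "admissible Y r m T"
  shows "size T \<le> card Y * r"
proof -
  have "count T x \<le> r" if "x \<in> Y" for x
    using assms that unfolding admissible_def
    using size_filter_mset_eq_sum_count[of "{x}" T] by (auto dest!: spec[of _ "{x}"])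
  then have "(\<Sum>x\<in>Y. count T x) \<le> card Y * r"
    using sum_bounded_above[of Y "count T" r] by simp
  moreover have "(filter_mset (\<lambda>x. x \<in> Y) T) = T"
    using assms(3) by (auto simp: admissible_def filter_mset_eq_conv)
  ultimately show ?thesis using assms(1) by (metis size_filter_mset_eq_sum_count)
qed

text \<open>A set \<open>I\<close> of size \<open>m\<close> on which \<open>t\<close> has maximal sum satisfies \<open>t x \<le> t y\<close> for all
  \<open>x \<notin> I\<close>, \<open>y \<in> I\<close>, so \<open>m * t x\<close> is at most that sum.\<close>
lemma sum_le_if_sums_of_size_le:
  fixes t :: "'x \<Rightarrow> nat"
  assumes Y: "finite Y" "m \<le> card Y"
    and t: "\<And>I. I \<subseteq> Y \<Longrightarrow> card I = m \<Longrightarrow> sum t I \<le> r"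
  shows "m * sum t Y \<le> r * card Y"
proof -
  let ?C = "{I. I \<subseteq> Y \<and> card I = m}"
  have "finite ?C" using Y by simp
  moreover have "?C \<noteq> {}" using Y by (auto elim: obtain_subset_with_card_n)
  ultimately have "Max (sum t ` ?C) \<in> sum t ` ?C" by (intro Max_in) auto
  then obtain I where I: "I \<in> ?C" and "sum t I = Max (sum t ` ?C)" by force
  then have Imax: "sum t J \<le> sum t I" if "J \<in> ?C" for J
    using that \<open>finite ?C\<close> by simp
  have finI: "finite I" using I Y(1) finite_subset[of I Y] by simp
  have le: "m * t x \<le> sum t I" if x: "x \<in> Y - I" for x
  proof -
    have "t x \<le> t y" if y: "y \<in> I" for y
    proof -
      \<comment> \<open>Exchanging y for x gives another m-subset, whose sum cannot exceed the
        maximal one.\<close>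
      have "insert x (I - {y}) \<in> ?C" using x y I finI card_Suc_Diff1[OF finI y] by auto
      then have "sum t (insert x (I - {y})) \<le> sum t I" by (rule Imax)
      then show ?thesis using x y finI by (simp add: sum.remove[of I y])
    qed
    then have "(\<Sum>y\<in>I. t x) \<le> sum t I" by (rule sum_mono)
    then show ?thesis using I by simp
  qed
  have "m * sum t Y = (\<Sum>x\<in>Y - I. m * t x) + m * sum t I"
    using I Y by (simp add: sum.subset_diff[of I Y] sum_distrib_left distrib_left)
  also have "\<dots> \<le> card (Y - I) * sum t I + card I * sum t I"
    using I sum_bounded_above[of "Y - I" "\<lambda>x. m * t x", OF le] by simp
  also have "\<dots> = card Y * sum t I"
    using I Y finI by (metis (no_types, lifting) add_mult_distrib card_Diff_subset card_mono
        le_add_diff_inverse2 mem_Collect_eq)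
  also have "\<dots> \<le> card Y * r" using t I by simp
  finally show ?thesis by (simp add: mult.commute)
qed


text \<open>A smaller I extends to exactly m points because Y has that many, and counts are
  nonnegative. For m > card Y the sum condition would be vacuous, while \<open>admissible\<close>
  still bounds T through I = Y.\<close>

lemma admissible_iff_sums_of_size:
  assumes "finite Y" "m \<le> card Y"
  shows "admissible Y r m T \<longleftrightarrow>
    set_mset T \<subseteq> Y \<and> (\<forall>I\<subseteq>Y. card I = m \<longrightarrow> (\<Sum>y\<in>I. count T y) \<le> r)" (is "?L \<longleftrightarrow> ?R")
proof
  show "?L \<Longrightarrow> ?R"
    using assms unfolding admissible_def by (metis finite_subset order_refl size_filter_mset_eq_sum_count)
next
  assume R: ?R
  have "size (filter_mset (\<lambda>x. x \<in> I) T) \<le> r" if I: "I \<subseteq> Y" "card I \<le> m" for I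
  proof -
    obtain J where J: "I \<subseteq> J" "J \<subseteq> Y" "card J = m"
      using exists_subset_between[OF I(2) assms(2) I(1) assms(1)] by blast
    then have "finite J" using assms(1) finite_subset[of J Y] by simp
    then have "(\<Sum>y\<in>I. count T y) \<le> (\<Sum>y\<in>J. count T y)" using J by (intro sum_mono2) auto
    also have "\<dots> \<le> r" using R J by blast
    finally show ?thesis
      using J \<open>finite J\<close> by (metis finite_subset size_filter_mset_eq_sum_count)
  qed
  then show ?L using R by (auto simp: admissible_def)
qed

lemma ex_mset_with_counts:
  assumes "finite Y"
  shows "\<exists>T. set_mset T \<subseteq> Y \<and> (\<forall>y\<in>Y. count T y = t y)"
proof (intro exI conjI ballI)
  let ?T = "\<Sum>y\<in>Y. replicate_mset (t y) y"
  show "set_mset ?T \<subseteq> Y" using assms by (auto simp: set_mset_sum split: if_splits)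
  show "count ?T y = t y" if "y \<in> Y" for y
    using assms that by (simp add: count_sum)
qed

lemma size_eq_sum_count:
  assumes "finite Y" "set_mset T \<subseteq> Y"
  shows "size T = (\<Sum>y\<in>Y. count T y)"
proof -
  have "filter_mset (\<lambda>x. x \<in> Y) T = T" using assms by (auto simp: filter_mset_eq_conv)
  then show ?thesis using assms(1) by (metis size_filter_mset_eq_sum_count)
qed

lemma sizes_of_admissible:
  assumes Y: "finite Y" "m \<le> card Y"
  shows "{size T | T. admissible Y r m T} =
    {\<Sum>i=1..card Y. t i | t :: nat \<Rightarrow> nat.
       \<forall>I\<subseteq>{1..card Y}. card I = m \<longrightarrow> (\<Sum>i\<in>I. t i) \<le> r}" (is "?A = ?B")
proof -
  obtain h where h: "bij_betw h {1..card Y} Y" using ex_bij_betw_nat_finite_1[OF Y(1)] by blast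
  then have inj: "inj_on h {1..card Y}" and im: "h ` {1..card Y} = Y" by (auto simp: bij_betw_def)
  have sub: "inj_on h I \<and> card (h ` I) = card I \<and> h ` I \<subseteq> Y" if "I \<subseteq> {1..card Y}" for I
    using that inj im by (auto simp: card_image inj_on_subset)
  show ?thesis
  proof (intro equalityI subsetI)
    fix N assume "N \<in> ?A"
    then obtain T where T: "N = size T" "admissible Y r m T" by blast
    define t where "t = (\<lambda>i. count T (h i))"
    have "(\<Sum>i\<in>I. t i) \<le> r" if "I \<subseteq> {1..card Y}" "card I = m" for I
    proof -
      have "(\<Sum>y\<in>h ` I. count T y) \<le> r"
        using T(2) sub[OF that(1)] that(2) by (simp add: admissible_iff_sums_of_size[OF Y])
      then show ?thesis using sub[OF that(1)] by (simp add: sum.reindex t_def)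
    qed
    moreover have "N = (\<Sum>i=1..card Y. t i)"
      using T size_eq_sum_count[OF Y(1), of T] sum.reindex_bij_betw[OF h, of "count T"]
      by (simp add: admissible_def t_def)
    ultimately show "N \<in> ?B" by blast
  next
    fix N assume "N \<in> ?B"
    then obtain t :: "nat \<Rightarrow> nat" where t: "N = (\<Sum>i=1..card Y. t i)"
      "\<And>I. I \<subseteq> {1..card Y} \<Longrightarrow> card I = m \<Longrightarrow> (\<Sum>i\<in>I. t i) \<le> r" by blast
    obtain T where T: "set_mset T \<subseteq> Y" "\<And>y. y \<in> Y \<Longrightarrow> count T y = t (inv_into {1..card Y} h y)"
      using ex_mset_with_counts[OF Y(1), of "\<lambda>y. t (inv_into {1..card Y} h y)"] by blast
    then have Th: "count T (h i) = t i" if "i \<in> {1..card Y}" for i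
    proof -
      have "h i \<in> Y" using that im by blast
      then show ?thesis using T(2) inv_into_f_f[OF inj that] by simp
    qed
    have "(\<Sum>y\<in>J. count T y) \<le> r" if "J \<subseteq> Y" "card J = m" for J
    proof -
      obtain I where I: "I \<subseteq> {1..card Y}" "J = h ` I" using \<open>J \<subseteq> Y\<close> im by (metis subset_imageE)
      have "(\<Sum>y\<in>J. count T y) = (\<Sum>i\<in>I. t i)"
        unfolding I(2) using sub[OF I(1)] Th I(1) by (simp add: sum.reindex) (intro sum.cong, auto)
      then show ?thesis using t(2) I sub[OF I(1)] that by simp
    qed
    then have "admissible Y r m T" using T(1) by (simp add: admissible_iff_sums_of_size[OF Y])
    moreover have "size T = N"
      unfolding size_eq_sum_count[OF Y(1) T(1)] t(1) sum.reindex_bij_betw[OF h, symmetric]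
      using Th by (intro sum.cong) auto
    ultimately show "N \<in> ?A" by blast
  qed
qed

text \<open>The lower bound comes from the constant multiplicity \<open>r div m\<close>, the upper
  one from comparing every point with the m heaviest ones, for which Y must have m points.\<close>

lemma maximum_size_of_admissible:
  assumes Y: "finite Y" and m: "1 \<le> m"
  obtains N where "is_maximum {size T | T. admissible Y r m T} N"
    and "r div m * card Y \<le> N" and "m \<le> card Y \<Longrightarrow> m * N \<le> r * card Y"
proof -
  let ?S = "{size T | T. admissible Y r m T}"
  have "finite ?S"
    using admissible_size_le[OF Y m] by (intro finite_subset[of ?S "{..card Y * r}"]) auto
  moreover have "size {#} \<in> ?S" by (rule CollectI) (auto simp: admissible_def intro!: exI[of _ "{#}"])
  ultimately have N: "is_maximum ?S (Max ?S)"
    unfolding is_maximum_def by (metis (lifting) Max_ge Max_in empty_iff)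
  obtain T where T: "set_mset T \<subseteq> Y" "\<And>y. y \<in> Y \<Longrightarrow> count T y = r div m"
    using ex_mset_with_counts[OF Y, of "\<lambda>_. r div m"] by blast
  have "admissible Y r m T"
    unfolding admissible_def
  proof (intro conjI allI impI)
    fix I assume I: "I \<subseteq> Y" "card I \<le> m"
    then have "size (filter_mset (\<lambda>x. x \<in> I) T) = card I * (r div m)"
      using T(2) Y finite_subset[OF I(1)] by (simp add: size_filter_mset_eq_sum_count subset_iff)
    also have "\<dots> \<le> m * (r div m)" using I(2) by (rule mult_right_mono) simp
    also have "\<dots> \<le> r" by (simp add: times_div_less_eq_dividend)
    finally show "size (filter_mset (\<lambda>x. x \<in> I) T) \<le> r" .
  qed (fact T(1))
  then have "r div m * card Y \<le> Max ?S"
    using N size_eq_sum_count[OF Y T(1)] T(2) by (auto simp: is_maximum_def mult.commute)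
  moreover have "m * Max ?S \<le> r * card Y" if "m \<le> card Y"
  proof -
    obtain T where T: "Max ?S = size T" "admissible Y r m T"
      using N unfolding is_maximum_def by blast
    have "m * (\<Sum>y\<in>Y. count T y) \<le> r * card Y"
      using T(2) admissible_iff_sums_of_size[OF Y that] by (intro sum_le_if_sums_of_size_le[OF Y that]) auto
    then show ?thesis using T size_eq_sum_count[OF Y] by (auto simp: admissible_def)
  qed
  ultimately show thesis using N that by blast
qed

section \<open>Sizes of feebly orthogonal families\<close>

lemma sizes_of_multifamilies:
  fixes \<nu> :: "'k::field \<Rightarrow> int extended" and f :: "('k ^ 'n) set \<Rightarrow> 'x"
  assumes Y: "finite Y" "f ` Gr s = Y"
    and R: "\<And>U V. U \<in> Gr s \<Longrightarrow> V \<in> Gr s \<Longrightarrow> feebly_orth \<nu> U V \<longleftrightarrow> f U \<noteq> f V"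
    and kl: "1 \<le> l" "l \<le> k"
  shows "{size F | F :: ('k ^ 'n) set multiset. feebly_orth_multifamily \<nu> s k l F} =
    {size T | T. admissible Y (k - 1) (l - 1) T}" (is "?A = ?B")
proof -
  have iff: "feebly_orth_multifamily \<nu> s k l F \<longleftrightarrow>
      set_mset F \<subseteq> Gr s \<and> admissible Y (k - 1) (l - 1) (image_mset f F)" for F :: "('k ^ 'n) set multiset"
    unfolding feebly_orth_multifamily_def
    using pairwise_separated_iff_admissible[of Y f "Gr s" "feebly_orth \<nu>" F l k] assms by blast
  show ?thesis
  proof (intro equalityI subsetI)
    fix N assume "N \<in> ?A"
    then obtain F :: "('k ^ 'n) set multiset" where "N = size F" "feebly_orth_multifamily \<nu> s k l F" by blast
    then have "admissible Y (k - 1) (l - 1) (image_mset f F)" "N = size (image_mset f F)"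
      using iff by auto
    then show "N \<in> ?B" by blast
  next
    fix N assume "N \<in> ?B"
    then obtain T where T: "N = size T" "admissible Y (k - 1) (l - 1) T" by blast
    \<comment> \<open>One preimage per value suffices, as a multifamily may repeat it.\<close>
    let ?F = "image_mset (inv_into (Gr s) f) T"
    have TY: "set_mset T \<subseteq> f ` Gr s" using T Y by (simp add: admissible_def)
    then have "f (inv_into (Gr s) f y) = y" if "y \<in># T" for y
      using that by (intro f_inv_into_f) blast
    then have "image_mset f ?F = T"
      by (simp add: multiset.map_comp o_def multiset.map_ident_strong)
    moreover have "set_mset ?F \<subseteq> Gr s" using TY inv_into_into[of _ f "Gr s"] by auto
    ultimately have "feebly_orth_multifamily \<nu> s k l ?F" "N = size ?F" using T iff[of ?F] by auto
    then show "N \<in> ?A" by blast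
  qed
qed

text \<open>Without repetition, the multiplicity \<open>count T y\<close> has to be realised by that
  many distinct subspaces over y; infinite fibres provide them.\<close>

lemma sizes_of_families:
  fixes \<nu> :: "'k::field \<Rightarrow> int extended" and f :: "('k ^ 'n) set \<Rightarrow> 'x"
  assumes Y: "finite Y" "f ` Gr s = Y"
    and R: "\<And>U V. U \<in> Gr s \<Longrightarrow> V \<in> Gr s \<Longrightarrow> feebly_orth \<nu> U V \<longleftrightarrow> f U \<noteq> f V"
    and kl: "2 \<le> l" "l \<le> k"
    and inf: "\<And>y. y \<in> Y \<Longrightarrow> infinite {U \<in> Gr s. f U = y}"
  shows "\<And>F :: ('k ^ 'n) set set. feebly_orth_family \<nu> s k l F \<Longrightarrow> finite F"
    and "{card F | F :: ('k ^ 'n) set set. feebly_orth_family \<nu> s k l F} =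
      {size T | T. admissible Y (k - 1) (l - 1) T}" (is "?A = ?B")
proof -
  have iff: "feebly_orth_family \<nu> s k l F \<longleftrightarrow>
      F \<subseteq> Gr s \<and> admissible Y (k - 1) (l - 1) (image_mset f (mset_set F))" if "finite F" for F :: "('k ^ 'n) set set"
    unfolding feebly_orth_family_iff_multifamily[OF that] feebly_orth_multifamily_def
    using that pairwise_separated_iff_admissible[of Y f "Gr s" "feebly_orth \<nu>" "mset_set F" l k] assms
    by auto
  show fin: "finite F" if F: "feebly_orth_family \<nu> s k l F" for F :: "('k ^ 'n) set set"
  proof (rule ccontr)
    assume "infinite F"
    \<comment> \<open>One member more than \<open>admissible_size_le\<close> permits, in a subfamily
      that inherits the property.\<close>
    then obtain F' where F': "F' \<subseteq> F" "finite F'" "card F' = Suc (card Y * (k - 1))"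
      by (meson infinite_arbitrarily_large)
    then have "feebly_orth_family \<nu> s k l F'" using F feebly_orth_family_subset by blast
    then have "size (image_mset f (mset_set F')) \<le> card Y * (k - 1)"
      using iff F'(2) kl by (intro admissible_size_le[OF Y(1), of "l - 1"]) auto
    then show False using F' by simp
  qed
  show "?A = ?B"
  proof (intro equalityI subsetI)
    fix N assume "N \<in> ?A"
    then obtain F :: "('k ^ 'n) set set" where F: "N = card F" "feebly_orth_family \<nu> s k l F" by blast
    then have "admissible Y (k - 1) (l - 1) (image_mset f (mset_set F))" using iff fin by blast
    moreover have "size (image_mset f (mset_set F)) = N" using F by simp
    ultimately show "N \<in> ?B" by blast
  next
    fix N assume "N \<in> ?B"
    then obtain T where T: "N = size T" "admissible Y (k - 1) (l - 1) T" by blast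
    have "\<exists>F. F \<subseteq> {U \<in> Gr s. f U = y} \<and> finite F \<and> card F = count T y" if "y \<in> Y" for y
      using infinite_arbitrarily_large[OF inf[OF that]] by metis
    then have "\<exists>F. \<forall>y\<in>Y. F y \<subseteq> {U \<in> Gr s. f U = y} \<and> finite (F y) \<and> card (F y) = count T y"
      by (intro bchoice) blast
    then obtain F where F: "\<And>y. y \<in> Y \<Longrightarrow> F y \<subseteq> {U \<in> Gr s. f U = y}"
      "\<And>y. y \<in> Y \<Longrightarrow> finite (F y)" "\<And>y. y \<in> Y \<Longrightarrow> card (F y) = count T y" by blast
    let ?F = "\<Union>y\<in>Y. F y"
    have finF: "finite ?F" using Y F(2) by blast
    have FT: "image_mset f (mset_set ?F) = T"
    proof (rule multiset_eqI)
      fix y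
      have "count (image_mset f (mset_set ?F)) y = card {U \<in> ?F. y = f U}"
        using finF by (simp add: count_image_mset')
      also have "\<dots> = count T y"
      proof (cases "y \<in> Y")
        case True
        then have "{U \<in> ?F. y = f U} = F y" using F(1) by blast
        then show ?thesis using F(3) True by simp
      next
        case False
        then have "{U \<in> ?F. y = f U} = {}" using F(1) by blast
        then show ?thesis using False T(2) by (metis admissible_def card.empty not_in_iff subsetD)
      qed
      finally show "count (image_mset f (mset_set ?F)) y = count T y" .
    qed
    have "?F \<subseteq> Gr s" using F(1) by blast
    then have "feebly_orth_family \<nu> s k l ?F" using iff[OF finF] T(2) FT by simp
    moreover have "N = card ?F" using T(1) by (simp flip: FT)
    ultimately show "N \<in> ?A" by blast
  qed
qed

section \<open>Reduction of subspaces\<close>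

locale nonarchimedean =
  fixes a :: "'k::field \<Rightarrow> real"
  assumes nonneg [simp]: "0 \<le> a x"
    and eq_0_iff [simp]: "a x = 0 \<longleftrightarrow> x = 0"
    and mult: "a (x * y) = a x * a y"
    and ultra: "a (x + y) \<le> max (a x) (a y)"
begin

lemma zero [simp]: "a 0 = 0" by simp

lemma one [simp]: "a 1 = 1"
  using mult[of 1 1] by simp

lemma minus [simp]: "a (- x) = a x"
proof -
  have "a (- 1) * a (- 1) = 1" using mult[of "- 1" "- 1"] by simp
  then have "a (- 1) = 1"
    by (metis abs_of_nonneg nonneg abs_mult_self_eq power2_eq_1_iff power2_eq_square abs_minus_cancel abs_one)
  then show ?thesis using mult[of "- 1" x] by simp
qed

lemma inverse: "a (inverse x) = inverse (a x)"
proof (cases "x = 0")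
  case False
  then have "a x * a (inverse x) = 1" by (simp flip: mult)
  then show ?thesis using inverse_unique by metis
qed simp

lemma power: "a (x ^ n) = a x ^ n"
  by (induction n) (simp_all add: mult)

end

text \<open>\<open>\<rho>\<close> is reduction modulo the maximal ideal, as a map on all of K with
  arbitrary values outside the valuation ring. Hence its axioms concern
  \<open>vabs \<nu> x \<le> 1\<close> only, and \<open>red\<close> below is meaningful on vectors of
  norm at most 1.\<close>

locale residue_map = nonarchimedean "vabs \<nu>"
  for \<nu> :: "'k::field \<Rightarrow> int extended" +
  fixes \<rho> :: "'k \<Rightarrow> 'f::{field,finite}"
  assumes nontrivial: "\<exists>x. x \<noteq> 0 \<and> vabs \<nu> x < 1"
    and \<rho>_add: "vabs \<nu> x \<le> 1 \<Longrightarrow> vabs \<nu> y \<le> 1 \<Longrightarrow> \<rho> (x + y) = \<rho> x + \<rho> y"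
    and \<rho>_mult: "vabs \<nu> x \<le> 1 \<Longrightarrow> vabs \<nu> y \<le> 1 \<Longrightarrow> \<rho> (x * y) = \<rho> x * \<rho> y"
    and \<rho>_eq_0: "vabs \<nu> x \<le> 1 \<Longrightarrow> \<rho> x = 0 \<longleftrightarrow> vabs \<nu> x < 1"
    and \<rho>_surj: "\<exists>x. vabs \<nu> x \<le> 1 \<and> \<rho> x = z"
begin

section \<open>The maximum norm on K^n\<close>

lemma vnorm_le_iff: "vnorm \<nu> v \<le> r \<longleftrightarrow> (\<forall>i. vabs \<nu> (v $ i) \<le> r)"
  by (simp add: vnorm_def)

lemma vnorm_less_iff: "vnorm \<nu> v < r \<longleftrightarrow> (\<forall>i. vabs \<nu> (v $ i) < r)"
  by (simp add: vnorm_def)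

lemma vabs_le_vnorm: "vabs \<nu> (v $ i) \<le> vnorm \<nu> v"
  using vnorm_le_iff by blast

lemma vnorm_attained: "\<exists>i. vnorm \<nu> v = vabs \<nu> (v $ i)"
proof -
  have "vnorm \<nu> v \<in> range (\<lambda>i. vabs \<nu> (v $ i))"
    unfolding vnorm_def by (intro Max_in) auto
  then show ?thesis by blast
qed

lemma vnorm_nonneg [simp]: "0 \<le> vnorm \<nu> v"
  by (metis nonneg vnorm_attained)

lemma vnorm_eq_0_iff [simp]: "vnorm \<nu> v = 0 \<longleftrightarrow> v = 0"
proof
  assume "vnorm \<nu> v = 0"
  then have "vabs \<nu> (v $ i) = 0" for i by (metis antisym nonneg vabs_le_vnorm)
  then show "v = 0" by (simp add: vec_eq_iff)
next
  assume "v = 0"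
  then show "vnorm \<nu> v = 0" using vnorm_attained[of v] by auto
qed

lemma vnorm_zero [simp]: "vnorm \<nu> 0 = 0"
  by simp

lemma vnorm_scale: "vnorm \<nu> (c *s v) = vabs \<nu> c * vnorm \<nu> v"
proof (rule antisym)
  show "vnorm \<nu> (c *s v) \<le> vabs \<nu> c * vnorm \<nu> v"
    by (simp add: vnorm_le_iff mult mult_left_mono vabs_le_vnorm)
  obtain i where "vnorm \<nu> v = vabs \<nu> (v $ i)" using vnorm_attained by blast
  then have "vabs \<nu> c * vnorm \<nu> v = vabs \<nu> ((c *s v) $ i)" by (simp add: mult)
  also have "\<dots> \<le> vnorm \<nu> (c *s v)" by (rule vabs_le_vnorm)
  finally show "vabs \<nu> c * vnorm \<nu> v \<le> vnorm \<nu> (c *s v)" .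
qed

lemma vnorm_add: "vnorm \<nu> (u + v) \<le> max (vnorm \<nu> u) (vnorm \<nu> v)"
  unfolding vnorm_le_iff
proof
  fix i
  have "vabs \<nu> ((u + v) $ i) \<le> max (vabs \<nu> (u $ i)) (vabs \<nu> (v $ i))" by (simp add: ultra)
  also have "\<dots> \<le> max (vnorm \<nu> u) (vnorm \<nu> v)" by (intro max.mono vabs_le_vnorm)
  finally show "vabs \<nu> ((u + v) $ i) \<le> max (vnorm \<nu> u) (vnorm \<nu> v)" .
qed

lemma vnorm_minus [simp]: "vnorm \<nu> (- v) = vnorm \<nu> v"
  by (simp add: vnorm_def)

text \<open>If the norm of u + v fell below the larger of the two norms, the longer vector would be
  a difference of two shorter ones.\<close>

lemma vnorm_add_eq_max:
  assumes "vnorm \<nu> u \<noteq> vnorm \<nu> v"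
  shows "vnorm \<nu> (u + v) = max (vnorm \<nu> u) (vnorm \<nu> v)"
  using assms vnorm_add[of u v] vnorm_add[of "u + v" "- v"] vnorm_add[of "u + v" "- u"]
  by (auto simp: max_def split: if_splits)

text \<open>The norm is the absolute value of some coordinate, so inverting that coordinate scales v
  to norm exactly 1.\<close>

lemma ex_normalisation:
  assumes "v \<noteq> 0"
  shows "\<exists>c. c \<noteq> 0 \<and> vnorm \<nu> (c *s v) = 1"
proof -
  obtain i where i: "vnorm \<nu> v = vabs \<nu> (v $ i)" using vnorm_attained by blast
  then have "v $ i \<noteq> 0" using assms by (metis eq_0_iff vnorm_eq_0_iff)
  then show ?thesis using i by (intro exI[of _ "inverse (v $ i)"]) (simp add: vnorm_scale inverse)
qed

lemma \<rho>_zero [simp]: "\<rho> 0 = 0"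
  by (simp add: \<rho>_eq_0)

lemma \<rho>_minus: "vabs \<nu> x \<le> 1 \<Longrightarrow> \<rho> (- x) = - \<rho> x"
  using \<rho>_add[of x "- x"] by (simp add: eq_neg_iff_add_eq_0 add.commute)

section \<open>Reduction of vectors and subspaces\<close>

definition red :: "'k ^ 'n \<Rightarrow> 'f ^ 'n" where
  "red v = (\<chi> i. \<rho> (v $ i))"

definition Red :: "('k ^ 'n) set \<Rightarrow> ('f ^ 'n) set" where
  "Red U = red ` {v \<in> U. vnorm \<nu> v \<le> 1}"

lemma red_add: "vnorm \<nu> u \<le> 1 \<Longrightarrow> vnorm \<nu> v \<le> 1 \<Longrightarrow> red (u + v) = red u + red v"
  by (simp add: vec_eq_iff red_def vnorm_le_iff \<rho>_add)

lemma red_minus: "vnorm \<nu> v \<le> 1 \<Longrightarrow> red (- v) = - red v"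
  by (simp add: vec_eq_iff red_def vnorm_le_iff \<rho>_minus)

lemma red_scale: "vabs \<nu> c \<le> 1 \<Longrightarrow> vnorm \<nu> v \<le> 1 \<Longrightarrow> red (c *s v) = \<rho> c *s red v"
  by (simp add: vec_eq_iff red_def vnorm_le_iff \<rho>_mult)

lemma red_zero [simp]: "red 0 = 0"
  by (simp add: vec_eq_iff red_def)

lemma red_eq_0_iff: "vnorm \<nu> v \<le> 1 \<Longrightarrow> red v = 0 \<longleftrightarrow> vnorm \<nu> v < 1"
  by (simp add: vec_eq_iff red_def vnorm_le_iff vnorm_less_iff \<rho>_eq_0)

lemma red_surj: "\<exists>v. vnorm \<nu> v \<le> 1 \<and> red v = w"
proof -
  have "\<exists>g. \<forall>y. vabs \<nu> (g y) \<le> 1 \<and> \<rho> (g y) = y" using \<rho>_surj by (intro choice) blast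
  then obtain g where "\<And>y. vabs \<nu> (g y) \<le> 1 \<and> \<rho> (g y) = y" by blast
  then show ?thesis
    by (intro exI[of _ "\<chi> i. g (w $ i)"]) (simp add: vnorm_le_iff red_def vec_eq_iff)
qed

lemma vnorm_scale_le_1: "vabs \<nu> c \<le> 1 \<Longrightarrow> vnorm \<nu> v \<le> 1 \<Longrightarrow> vnorm \<nu> (c *s v) \<le> 1"
  by (simp add: vnorm_scale mult_le_one)

lemma vnorm_add_le_1: "vnorm \<nu> u \<le> 1 \<Longrightarrow> vnorm \<nu> v \<le> 1 \<Longrightarrow> vnorm \<nu> (u + v) \<le> 1"
  using vnorm_add[of u v] by simp

lemma subspace_Red:
  assumes U: "vec.subspace U"
  shows "vec.subspace (Red U)"
proof (rule vec.subspaceI)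
  show "0 \<in> Red U"
    unfolding Red_def using vec.subspace_0[OF U] by (intro image_eqI[of _ _ 0]) auto
next
  fix x y assume "x \<in> Red U" "y \<in> Red U"
  then obtain u v where "u \<in> U" "v \<in> U" "vnorm \<nu> u \<le> 1" "vnorm \<nu> v \<le> 1" "x = red u" "y = red v"
    by (auto simp: Red_def)
  then show "x + y \<in> Red U"
    unfolding Red_def using vec.subspace_add[OF U]
    by (intro image_eqI[of _ _ "u + v"]) (auto simp: red_add vnorm_add_le_1)
next
  fix d x assume "x \<in> Red U"
  then obtain u where "u \<in> U" "vnorm \<nu> u \<le> 1" "x = red u" by (auto simp: Red_def)
  moreover obtain c where "vabs \<nu> c \<le> 1" "\<rho> c = d" using \<rho>_surj by blast
  ultimately show "d *s x \<in> Red U"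
    unfolding Red_def using vec.subspace_scale[OF U]
    by (intro image_eqI[of _ _ "c *s u"]) (auto simp: red_scale vnorm_scale_le_1)
qed

text \<open>After division by \<open>c\<close>, the only case of the max identity for \<open>c *s u\<close> and \<open>v\<close> that is not
  automatic is that of two vectors of norm 1, where a failure would mean \<open>red u = red (- v)\<close>.\<close>
lemma orth_if_red_notin:
  assumes V: "vec.subspace V" and u: "vnorm \<nu> u \<le> 1" "red u \<notin> Red V"
  shows "orth \<nu> (vec.span {u}) V"
  unfolding orth_def orth_vec_def
proof (intro ballI allI)
  \<comment> \<open>\<open>Red V\<close> contains 0, so u does not reduce to 0 and has norm exactly
    1.\<close>
  have "red u \<noteq> 0" using u(2) subspace_Red[OF V] vec.subspace_0 by metis
  then have u1: "vnorm \<nu> u = 1" using u(1) red_eq_0_iff[of u] by simp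
  \<comment> \<open>One scalar suffices: V absorbs d, and c times a multiple of u is a multiple of
    u.\<close>
  have *: "vnorm \<nu> (c *s u + v) = max (vnorm \<nu> (c *s u)) (vnorm \<nu> v)" if v: "v \<in> V" for c v
  proof (cases "vnorm \<nu> (c *s u) = vnorm \<nu> v \<and> c \<noteq> 0")
    case True
    then have c: "c \<noteq> 0" "vabs \<nu> c = vnorm \<nu> v" using u1 by (simp_all add: vnorm_scale)
    define w where "w = inverse c *s v"
    have w: "w \<in> V" "vnorm \<nu> w = 1" "c *s u + v = c *s (u + w)"
      using c v vec.subspace_scale[OF V]
      by (auto simp: w_def vnorm_scale inverse vector_ssub_ldistrib vector_add_ldistrib
          simp flip: c(2))
    have "vnorm \<nu> (u + w) = 1"
    proof (rule ccontr)
      assume "vnorm \<nu> (u + w) \<noteq> 1"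
      then have "vnorm \<nu> (u + w) < 1" using vnorm_add_le_1[of u w] u1 w(2) by simp
      then have "red (u + w) = 0" using red_eq_0_iff[of "u + w"] by simp
      then have "red u = red (- w)"
        using red_add[of u w] u1 w(2) by (simp add: red_minus eq_neg_iff_add_eq_0)
      moreover have "- w \<in> V" using V w(1) by (rule vec.subspace_neg)
      ultimately show False using u(2) w(2) unfolding Red_def by auto
    qed
    then show ?thesis unfolding w(3) vnorm_scale using c u1 by simp
  next
    case False
    then show ?thesis using vnorm_add_eq_max[of "c *s u" v] by (auto simp: max_def)
  qed
  fix x v c d assume x: "x \<in> vec.span {u}" and v: "v \<in> V"
  obtain e where e: "x = e *s u" using x by (auto simp: vec.span_singleton)
  show "vnorm \<nu> (c *s x + d *s v) = max (vnorm \<nu> (c *s x)) (vnorm \<nu> (d *s v))"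
    using *[of "d *s v" "c * e"] vec.subspace_scale[OF V v] by (simp add: e)
qed

text \<open>If the reductions agreed, a multiple of u of norm 1 would share its reduction with some
  v in V. Their difference would have norm below 1, but orthogonality gives it norm at least
  1.\<close>

lemma Red_neq_if_orth:
  assumes U: "vec.subspace U" and u: "u \<in> U" "u \<noteq> 0" and o: "orth \<nu> (vec.span {u}) V"
  shows "Red U \<noteq> Red V"
proof
  assume eq: "Red U = Red V"
  obtain c where c: "vnorm \<nu> (c *s u) = 1" using ex_normalisation[OF u(2)] by blast
  have "red (c *s u) \<in> Red U"
    using c vec.subspace_scale[OF U u(1)] by (auto simp: Red_def)
  then obtain v where v: "v \<in> V" "vnorm \<nu> v \<le> 1" "red (c *s u) = red v" using eq by (auto simp: Red_def)
  have "red (c *s u + - v) = 0" using c v by (subst red_add) (auto simp: red_minus)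
  then have "vnorm \<nu> (c *s u + - v) < 1"
    using red_eq_0_iff[of "c *s u + - v"] vnorm_add_le_1[of "c *s u" "- v"] c v by simp
  moreover have "c *s u \<in> vec.span {u}" by (simp add: vec.span_base vec.span_scale)
  then have "vnorm \<nu> (1 *s (c *s u) + (- 1) *s v) = max (vnorm \<nu> (1 *s (c *s u))) (vnorm \<nu> ((- 1) *s v))"
    using o v(1) unfolding orth_def orth_vec_def by blast
  ultimately show False using c by simp
qed

text \<open>The two disjuncts of \<open>feebly_orth\<close> correspond to the two ways in which the
  reductions can differ: an element of \<open>Red U\<close> outside \<open>Red V\<close>, or
  conversely.\<close>

lemma feebly_orth_iff_Red_neq:
  assumes "vec.subspace U" "vec.subspace V"
  shows "feebly_orth \<nu> U V \<longleftrightarrow> Red U \<noteq> Red V"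
proof
  assume "feebly_orth \<nu> U V"
  then show "Red U \<noteq> Red V"
    unfolding feebly_orth_def using Red_neq_if_orth assms by (metis DiffD1 DiffD2 singletonI)
next
  have *: "\<exists>u\<in>U - {0}. orth \<nu> (vec.span {u}) V"
    if U: "vec.subspace U" and V: "vec.subspace V" and w: "w \<in> Red U" "w \<notin> Red V"
    for U V :: "('k ^ 'n) set" and w
  proof -
    obtain u where u: "u \<in> U" "vnorm \<nu> u \<le> 1" "red u = w" using w(1) by (auto simp: Red_def)
    moreover have "w \<noteq> 0" using w(2) subspace_Red[OF V] vec.subspace_0 by metis
    then have "u \<noteq> 0" using u(3) by auto
    ultimately show ?thesis using orth_if_red_notin[OF V] w(2) by blast
  qed
  assume "Red U \<noteq> Red V"
  then consider w where "w \<in> Red U" "w \<notin> Red V" | w where "w \<in> Red V" "w \<notin> Red U" by blast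
  then show "feebly_orth \<nu> U V"
  proof cases
    case 1
    from *[OF assms this] show ?thesis by (simp add: feebly_orth_def)
  next
    case 2
    from *[OF assms(2,1) this] show ?thesis by (simp add: feebly_orth_def)
  qed
qed

section \<open>Lifting bases from F_q^n to K^n\<close>

lemma red_sum:
  assumes "finite A" "\<And>b. b \<in> A \<Longrightarrow> vabs \<nu> (c b) \<le> 1" "\<And>b. b \<in> A \<Longrightarrow> vnorm \<nu> (f b) \<le> 1"
  shows "vnorm \<nu> (\<Sum>b\<in>A. c b *s f b) \<le> 1 \<and>
    red (\<Sum>b\<in>A. c b *s f b) = (\<Sum>b\<in>A. \<rho> (c b) *s red (f b))"
  using assms
  by (induction A rule: finite_induct) (simp_all add: red_add red_scale vnorm_add_le_1 vnorm_scale_le_1)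

text \<open>Let d be the inverse of a coefficient of largest absolute value. All coefficients become
  integral and this one becomes 1, which survives reduction.\<close>

lemma ex_coefficient_normalisation:
  assumes "finite A" "b \<in> A" "c b \<noteq> 0"
  shows "\<exists>d. d \<noteq> 0 \<and> (\<forall>b\<in>A. vabs \<nu> (d * c b) \<le> 1) \<and> (\<exists>b\<in>A. \<rho> (d * c b) \<noteq> 0)"
proof -
  let ?M = "Max ((\<lambda>b. vabs \<nu> (c b)) ` A)"
  have "?M \<in> (\<lambda>b. vabs \<nu> (c b)) ` A" using assms by (intro Max_in) auto
  then obtain e where e: "e \<in> A" "vabs \<nu> (c e) = ?M" by force
  then have le: "vabs \<nu> (c x) \<le> vabs \<nu> (c e)" if "x \<in> A" for x using assms(1) that by simp
  have "0 < vabs \<nu> (c b)" using assms(3) by (metis eq_0_iff nonneg order_le_less)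
  then have pos: "0 < vabs \<nu> (c e)" using le[OF assms(2)] by simp
  then have "c e \<noteq> 0" by auto
  show ?thesis
  proof (intro exI conjI ballI bexI)
    show "inverse (c e) \<noteq> 0" "\<rho> (inverse (c e) * c e) \<noteq> 0"
      using \<open>c e \<noteq> 0\<close> by (simp_all add: \<rho>_eq_0)
    show "e \<in> A" by (fact e(1))
    fix x assume "x \<in> A"
    from le[OF this] show "vabs \<nu> (inverse (c e) * c x) \<le> 1"
      unfolding mult inverse using pos by (simp add: field_simps)
  qed
qed

text \<open>A predicate rather than one fixed section of \<open>red\<close>, because
  \<open>dim_Red\<close> wants lifts inside U and \<open>infinite_Red_fibre\<close> varies the lift
  of a basis vector.\<close>

definition lifts :: "('f ^ 'n \<Rightarrow> 'k ^ 'n) \<Rightarrow> ('f ^ 'n) set \<Rightarrow> bool" where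
  "lifts f A \<longleftrightarrow> (\<forall>b\<in>A. vnorm \<nu> (f b) \<le> 1 \<and> red (f b) = b)"

lemma lifts_inj_on: "lifts f A \<Longrightarrow> inj_on f A"
  by (metis inj_onI lifts_def)

lemma lifts_subset: "lifts f A \<Longrightarrow> D \<subseteq> A \<Longrightarrow> lifts f D"
  by (auto simp: lifts_def)

lemma lifts_red_sum:
  assumes "lifts f A" "\<And>b. b \<in> A \<Longrightarrow> vabs \<nu> (c b) \<le> 1"
  shows "vnorm \<nu> (\<Sum>b\<in>A. c b *s f b) \<le> 1"
    and "red (\<Sum>b\<in>A. c b *s f b) = (\<Sum>b\<in>A. \<rho> (c b) *s b)"
  using red_sum[of A c f] assms by (simp_all add: lifts_def)

text \<open>A nontrivial relation among the lifts, once normalised, would reduce to a nontrivial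
  relation on A.\<close>

lemma lifts_independent:
  assumes A: "vec.independent A" and f: "lifts f A"
  shows "vec.independent (f ` A)"
proof (rule vec.independent_if_scalars_zero)
  show "finite (f ` A)" by simp
  fix g x assume sum: "(\<Sum>x\<in>f ` A. g x *s x) = 0" and x: "x \<in> f ` A"
  show "g x = 0"
  proof (rule ccontr)
    assume "g x \<noteq> 0"
    then obtain b where b: "b \<in> A" "g (f b) \<noteq> 0" using x by blast
    obtain d where d: "\<forall>b\<in>A. vabs \<nu> (d * g (f b)) \<le> 1" "\<exists>b\<in>A. \<rho> (d * g (f b)) \<noteq> 0"
      using ex_coefficient_normalisation[of A b "\<lambda>b. g (f b)"] b by auto
    have "(\<Sum>b\<in>A. (d * g (f b)) *s f b) = d *s (\<Sum>b\<in>A. g (f b) *s f b)"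
      by (simp add: vec.scale_sum_right)
    also have "\<dots> = 0" using sum lifts_inj_on[OF f] by (simp add: sum.reindex)
    finally have "(\<Sum>b\<in>A. \<rho> (d * g (f b)) *s b) = 0"
      using lifts_red_sum(2)[OF f, of "\<lambda>b. d * g (f b)"] d(1) by simp
    then have "\<rho> (d * g (f b)) = 0" if "b \<in> A" for b
      using vec.independentD[OF A, of A "\<lambda>b. \<rho> (d * g (f b))" b] that by simp
    then show False using d(2) by simp
  qed
qed

text \<open>Extend a basis of \<open>Red U\<close> to the whole space and lift it, with lifts in \<open>U\<close> where possible. An
  element of \<open>U\<close> outside the span of the latter would, suitably scaled, reduce to a nonzero
  combination of the added basis vectors.\<close>
lemma dim_Red:
  fixes U :: "('k ^ 'n) set"
  assumes U: "vec.subspace U"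
  shows "vec.dim (Red U) = vec.dim U"
proof -
  obtain A where A: "A \<subseteq> Red U" "vec.independent A" "Red U \<subseteq> vec.span A" "card A = vec.dim (Red U)"
    using vec.basis_exists by blast
  obtain C where C: "A \<subseteq> C" "C \<subseteq> UNIV" "vec.independent C" "UNIV \<subseteq> vec.span C"
    by (rule vec.maximal_independent_subset_extend[OF subset_UNIV A(2)])
  have "\<exists>v. vnorm \<nu> v \<le> 1 \<and> red v = b \<and> (b \<in> A \<longrightarrow> v \<in> U)" for b
  proof (cases "b \<in> A")
    case True
    then have "b \<in> red ` {v \<in> U. vnorm \<nu> v \<le> 1}" using A(1) unfolding Red_def by (rule subsetD[rotated])
    then show ?thesis by force
  next
    case False
    then show ?thesis using red_surj[of b] by simp
  qed
  then have "\<exists>f. \<forall>b. vnorm \<nu> (f b) \<le> 1 \<and> red (f b) = b \<and> (b \<in> A \<longrightarrow> f b \<in> U)"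
    by (intro choice) blast
  then obtain f where f: "\<And>b. vnorm \<nu> (f b) \<le> 1 \<and> red (f b) = b \<and> (b \<in> A \<longrightarrow> f b \<in> U)"
    by blast
  then have lC: "lifts f C" by (simp add: lifts_def)
  have lA: "lifts f A" using f by (simp add: lifts_def)
  have fA: "vec.independent (f ` A)" "card (f ` A) = card A" "f ` A \<subseteq> U"
    using lifts_independent[OF A(2) lA] lifts_inj_on[OF lA] f by (auto simp: card_image)
  \<comment> \<open>C is a basis of F_q^n, so its lift is an independent set of
    \<open>CARD('n)\<close> vectors and spans K^n.\<close>
  have "vec.dim (UNIV :: ('f ^ 'n) set) = card C" using vec.basis_card_eq_dim[OF C(2,4,3)] by simp
  then have "card (f ` C) = CARD('n)"
    using card_image[OF lifts_inj_on[OF lC]] by (simp add: card_cart_basis)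
  then have spanC: "UNIV \<subseteq> vec.span (f ` C)"
    using vec.card_ge_dim_independent[OF subset_UNIV lifts_independent[OF C(3) lC]]
    by (simp add: card_cart_basis)
  have "U \<subseteq> vec.span (f ` A)"
  proof
    fix u assume u: "u \<in> U"
    have "u \<in> range (\<lambda>g. \<Sum>v\<in>f ` C. g v *s v)" using spanC vec.span_finite[of "f ` C"] by auto
    then obtain g where "u = (\<Sum>v\<in>f ` C. g v *s v)" by blast
    then have "u = (\<Sum>c\<in>C. g (f c) *s f c)" using lifts_inj_on[OF lC] by (simp add: sum.reindex)
    then have split: "u = (\<Sum>c\<in>C - A. g (f c) *s f c) + (\<Sum>c\<in>A. g (f c) *s f c)"
      using C(1) by (simp add: sum.subset_diff)
    \<comment> \<open>The part of u on the lifts of C - A. It lies in U because the lifts of A were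
      chosen there.\<close>
    let ?y = "\<Sum>c\<in>C - A. g (f c) *s f c"
    have inA: "(\<Sum>c\<in>A. g (f c) *s f c) \<in> vec.span (f ` A)"
      by (intro vec.span_sum vec.span_scale vec.span_base) auto
    moreover have "vec.span (f ` A) \<subseteq> U" using fA(3) U by (rule vec.span_minimal)
    ultimately have "u - (\<Sum>c\<in>A. g (f c) *s f c) \<in> U" using vec.subspace_diff[OF U u] by blast
    moreover have "u - (\<Sum>c\<in>A. g (f c) *s f c) = ?y" using split by (simp add: diff_eq_eq)
    ultimately have y: "?y \<in> U" by (simp only:)
    have "g (f c) = 0" if c: "c \<in> C - A" for c
    proof (rule ccontr)
      assume "g (f c) \<noteq> 0"
      then obtain d where d: "\<forall>b\<in>C - A. vabs \<nu> (d * g (f b)) \<le> 1"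
          "\<exists>b\<in>C - A. \<rho> (d * g (f b)) \<noteq> 0"
        using ex_coefficient_normalisation[of "C - A" c "\<lambda>b. g (f b)"] c by auto
      let ?e = "\<lambda>b. \<rho> (d * g (f b))"
      have dy: "d *s ?y = (\<Sum>b\<in>C - A. (d * g (f b)) *s f b)" by (simp add: vec.scale_sum_right)
      have lCA: "lifts f (C - A)" using lC lifts_subset by blast
      have "d *s ?y \<in> {v \<in> U. vnorm \<nu> v \<le> 1}"
        using vec.subspace_scale[OF U y, of d] lifts_red_sum(1)[OF lCA, of "\<lambda>b. d * g (f b)"] d(1)
        unfolding dy by simp
      \<comment> \<open>This element of \<open>Red U\<close> is a combination of A, and also one of
        C - A with a nonzero coefficient.\<close>
      then have "red (d *s ?y) \<in> vec.span A" using A(3) unfolding Red_def by blast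
      moreover have "red (d *s ?y) = (\<Sum>b\<in>C - A. ?e b *s b)"
        using lifts_red_sum(2)[OF lCA, of "\<lambda>b. d * g (f b)"] d(1) unfolding dy by simp
      ultimately obtain h where h: "(\<Sum>b\<in>C - A. ?e b *s b) = (\<Sum>b\<in>A. h b *s b)"
        using vec.span_finite[of A] by auto
      \<comment> \<open>\<open>?k\<close> joins both expressions into one relation on the
        independent set C, forcing every \<open>?e b\<close> on C - A to vanish.\<close>
      let ?k = "\<lambda>b. if b \<in> A then - h b else ?e b"
      have "(\<Sum>b\<in>C. ?k b *s b) = (\<Sum>b\<in>C - A. ?k b *s b) + (\<Sum>b\<in>A. ?k b *s b)"
        using C(1) by (simp add: sum.subset_diff)
      also have "\<dots> = (\<Sum>b\<in>C - A. ?e b *s b) + - (\<Sum>b\<in>A. h b *s b)"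
        by (intro arg_cong2[of _ _ _ _ "(+)"]) (auto simp: sum_negf[symmetric] intro!: sum.cong)
      also have "\<dots> = 0" using h by simp
      finally have k0: "?k b = 0" if "b \<in> C" for b
        using vec.independentD[OF C(3), of C ?k b] that by simp
      obtain b where "b \<in> C - A" "?e b \<noteq> 0" using d(2) by blast
      then show False using k0[of b] by simp
    qed
    then have "?y = 0" by simp
    then show "u \<in> vec.span (f ` A)" using split inA by simp
  qed
  then have "vec.dim U \<le> card (f ` A)" by (rule vec.dim_le_card) simp
  moreover have "card (f ` A) \<le> vec.dim U" using fA by (intro vec.independent_card_le_dim)
  ultimately show ?thesis using A(4) fA(2) by simp
qed

lemma Red_in_Gr: "U \<in> Gr s \<Longrightarrow> Red U \<in> Gr s"
  by (simp add: Gr_def subspace_Red dim_Red)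

text \<open>The reduction of the span contains A, hence W, and both have dimension s. As any lifts
  will do, this yields surjectivity of \<open>Red\<close> and, by varying f, many preimages.\<close>

lemma span_lifts:
  assumes W: "W \<in> Gr s" and A: "A \<subseteq> W" "vec.independent A" "W \<subseteq> vec.span A" and f: "lifts f A"
  shows "vec.span (f ` A) \<in> Gr s" and "Red (vec.span (f ` A)) = W"
proof -
  let ?U = "vec.span (f ` A)"
  have "card A = s" using W A vec.basis_card_eq_dim[of A W] by (simp add: Gr_def)
  then have "card (f ` A) = s" using lifts_inj_on[OF f] by (simp add: card_image)
  then show U: "?U \<in> Gr s"
    using vec.dim_span_eq_card_independent[OF lifts_independent[OF A(2) f]]
    by (simp add: Gr_def vec.subspace_span)
  have "A \<subseteq> Red ?U"
  proof
    fix b assume "b \<in> A"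
    then show "b \<in> Red ?U"
      using f unfolding Red_def lifts_def by (intro image_eqI[of _ _ "f b"]) (auto intro: vec.span_base)
  qed
  then have "W \<subseteq> Red ?U"
    using A(3) vec.span_minimal[OF _ subspace_Red[OF vec.subspace_span]] by blast
  then show "Red ?U = W"
    using W Red_in_Gr[OF U] vec.subspace_dim_equal[of W "Red ?U"] by (simp add: Gr_def)
qed

lemma Red_Gr: "Red ` Gr s = (Gr s :: ('f ^ 'n) set set)"
proof (intro equalityI subsetI)
  fix W :: "('f ^ 'n) set" assume W: "W \<in> Gr s"
  obtain A where A: "A \<subseteq> W" "vec.independent A" "W \<subseteq> vec.span A" using vec.basis_exists by metis
  have "\<exists>f. \<forall>b. vnorm \<nu> (f b) \<le> 1 \<and> red (f b) = (b :: 'f ^ 'n)" using red_surj by (intro choice) blast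
  then obtain f where "lifts f A" unfolding lifts_def by blast
  from span_lifts[OF W A this] show "W \<in> Red ` Gr s" by (metis imageI)
qed (auto simp: Red_in_Gr)

text \<open>Perturbing the lift of one basis vector of \<open>W\<close> by multiples, of absolute value less than 1, of a
  lift of a vector outside \<open>W\<close> yields infinitely many preimages of \<open>W\<close>.\<close>
lemma infinite_Red_fibre:
  fixes W :: "('f ^ 'n) set"
  assumes W: "W \<in> Gr s" and s: "1 \<le> s" "s < CARD('n)"
  shows "infinite {U \<in> Gr s. Red U = W}"
proof -
  obtain A where A: "A \<subseteq> W" "vec.independent A" "W \<subseteq> vec.span A" "card A = vec.dim W"
    using vec.basis_exists by metis
  then have "A \<noteq> {}" using W s by (auto simp: Gr_def)
  then obtain b where b: "b \<in> A" by blast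
  have "W \<noteq> UNIV" using W s by (auto simp: Gr_def card_cart_basis)
  then obtain w where w: "w \<notin> W" by blast
  have "\<exists>f. \<forall>b. vnorm \<nu> (f b) \<le> 1 \<and> red (f b) = (b :: 'f ^ 'n)" using red_surj by (intro choice) blast
  then obtain f where f: "\<And>b. vnorm \<nu> (f b) \<le> 1 \<and> red (f b) = (b :: 'f ^ 'n)" by blast
  obtain t where t: "t \<noteq> 0" "vabs \<nu> t < 1" using nontrivial by blast
  have t0: "0 < vabs \<nu> t" using t by (metis eq_0_iff nonneg order_le_less)
  \<comment> \<open>The exponent starts at 1, so that every \<open>c i\<close> has absolute value
    below 1; different i give different absolute values.\<close>
  define c where "c i = t ^ Suc i" for i
  have ci: "vabs \<nu> (c i) < 1" for i
    using t t0 power_Suc_less_one[of "vabs \<nu> t" i] by (simp add: c_def power del: power_Suc)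
  define g where "g i = f(b := f b + c i *s f w)" for i
  define V where "V i = vec.span (g i ` A)" for i
  \<comment> \<open>\<open>\<rho> (c i)\<close> is 0, so the perturbed vector still reduces to
    b.\<close>
  have "lifts (g i) A" for i
    using f ci[of i] \<rho>_eq_0[of "c i"]
    by (auto simp: lifts_def g_def red_add red_scale vnorm_add_le_1 vnorm_scale_le_1)
  then have V: "V i \<in> Gr s" "Red (V i) = W" for i
    unfolding V_def using span_lifts[OF W A(1-3)] by blast+
  have "inj V"
  proof (rule injI, rule ccontr)
    fix i j assume eq: "V i = V j" and "i \<noteq> j"
    have sub: "vec.subspace (V i)" using V(1) by (simp add: Gr_def)
    have "f b + c m *s f w \<in> V m" for m
      unfolding V_def by (intro vec.span_base image_eqI[of _ _ b]) (auto simp: g_def b)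
    \<comment> \<open>The two lifts of b differ by a nonzero multiple of \<open>f w\<close>, so a
      common span would contain \<open>f w\<close>, and its reduction W would contain w.\<close>
    then have "(f b + c i *s f w) - (f b + c j *s f w) \<in> V i"
      using eq vec.subspace_diff[OF sub] by metis
    then have "(c i - c j) *s f w \<in> V i" by (simp add: vec.scale_left_diff_distrib)
    moreover have "c i \<noteq> c j"
    proof
      assume "c i = c j"
      then have "vabs \<nu> t ^ Suc i = vabs \<nu> t ^ Suc j" by (metis c_def power)
      then show False using \<open>i \<noteq> j\<close> t t0 power_inject_exp'[of "vabs \<nu> t" "Suc i" "Suc j"] by simp
    qed
    then have "inverse (c i - c j) *s ((c i - c j) *s f w) = f w"
      by (simp only: vec.scale_scale vec.scale_one left_inverse eq_iff_diff_eq_0[symmetric] not_False_eq_True)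
    ultimately have "f w \<in> V i" using vec.subspace_scale[OF sub] by metis
    then have "w \<in> Red (V i)" unfolding Red_def using f by (intro image_eqI[of _ _ "f w"]) auto
    then show False using w V(2) by simp
  qed
  then have "infinite (range V)" by (rule range_inj_infinite)
  moreover have "range V \<subseteq> {U \<in> Gr s. Red U = W}" using V by blast
  ultimately show ?thesis using finite_subset by blast
qed

end

section \<open>The residue map of a discrete valuation\<close>

lemma vabs_Fin: "\<nu> x = Fin i \<Longrightarrow> vabs \<nu> x = real (card (carrier (residue_field \<nu>))) powi (- i)"
  by (simp add: vabs_def)

text \<open>For a base q > 1 the map from i to q^(-i) is strictly decreasing, so the laws of
  \<open>\<nu>\<close> become those of \<open>vabs\<close>. A cardinality above 1 also entails
  finiteness, as \<open>card\<close> is 0 on infinite sets.\<close>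

lemma nonarchimedean_vabs:
  assumes \<nu>: "discrete_valuation \<nu>" and q: "1 < card (carrier (residue_field \<nu>))"
  shows "nonarchimedean (vabs \<nu>)"
    and "vabs \<nu> x \<le> 1 \<longleftrightarrow> 0 \<le> \<nu> x" and "vabs \<nu> x < 1 \<longleftrightarrow> 0 < \<nu> x"
proof -
  let ?q = "real (card (carrier (residue_field \<nu>)))"
  have q1: "1 < ?q" using q by simp
  have \<nu>0: "\<nu> 0 = Pinf" using \<nu> by (simp add: discrete_valuation_def)
  then have zero: "vabs \<nu> 0 = 0" by (simp add: vabs_def)
  have fin: "\<exists>i. \<nu> x = Fin i" if "x \<noteq> 0" for x
    using \<nu> that by (cases "\<nu> x") (auto simp: discrete_valuation_def)
  have pos: "0 < vabs \<nu> x" if "x \<noteq> 0" for x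
    using fin[OF that] q1 by (auto simp: vabs_Fin intro!: zero_less_power_int)
  have le: "?q powi (- i) \<le> ?q powi (- j) \<longleftrightarrow> j \<le> i" for i j
    using power_int_increasing[of "- i" "- j" ?q] power_int_strict_increasing[of "- j" "- i" ?q] q1
    by (cases "j \<le> i") auto
  show "nonarchimedean (vabs \<nu>)"
  proof
    fix x y
    show "0 \<le> vabs \<nu> x" using pos[of x] zero by (cases "x = 0") auto
    show "vabs \<nu> x = 0 \<longleftrightarrow> x = 0" using pos[of x] zero by (cases "x = 0") auto
    show "vabs \<nu> (x * y) = vabs \<nu> x * vabs \<nu> y"
    proof (cases "x = 0 \<or> y = 0")
      case False
      then obtain i j where ij: "\<nu> x = Fin i" "\<nu> y = Fin j" using fin by blast
      then have "\<nu> (x * y) = Fin (i + j)" using \<nu> by (simp add: discrete_valuation_def)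
      then have "vabs \<nu> (x * y) = ?q powi (- i + - j)" by (simp add: vabs_Fin)
      also have "\<dots> = ?q powi (- i) * ?q powi (- j)" using q1 by (intro power_int_add) auto
      finally show ?thesis using ij by (simp only: vabs_Fin)
    qed (auto simp: zero)
    show "vabs \<nu> (x + y) \<le> max (vabs \<nu> x) (vabs \<nu> y)"
    proof (cases "x = 0 \<or> y = 0 \<or> x + y = 0")
      case True
      then show ?thesis using zero pos[of x] pos[of y] by (cases "x = 0"; cases "y = 0") auto
    next
      case False
      then obtain i j m where ij: "\<nu> x = Fin i" "\<nu> y = Fin j" "\<nu> (x + y) = Fin m" using fin by metis
      have "min (\<nu> x) (\<nu> y) \<le> \<nu> (x + y)" using \<nu> by (simp add: discrete_valuation_def)
      then have "i \<le> m \<or> j \<le> m" using ij by (auto simp: min_def split: if_splits)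
      then show ?thesis by (simp only: ij[THEN vabs_Fin[of \<nu>]] le_max_iff_disj le)
    qed
  qed
  show "vabs \<nu> x \<le> 1 \<longleftrightarrow> 0 \<le> \<nu> x" "vabs \<nu> x < 1 \<longleftrightarrow> 0 < \<nu> x"
    using fin[of x] zero \<nu>0 le[of _ 0] le[of 0]
    by (cases "x = 0"; auto simp: vabs_Fin zero_extended_def simp flip: not_le)+
qed

lemma ring_of_type_algebra_simps:
  "carrier (ring_of_type_algebra :: 'a::ring_1 ring) = UNIV"
  "mult (ring_of_type_algebra :: 'a ring) = (*)" "one (ring_of_type_algebra :: 'a ring) = 1"
  "ring.zero (ring_of_type_algebra :: 'a ring) = 0" "add (ring_of_type_algebra :: 'a ring) = (+)"
  by (simp_all add: ring_of_type_algebra_def)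

lemma valuation_ring_simps:
  "carrier (valuation_ring \<nu>) = {x. 0 \<le> \<nu> x}"
  "mult (valuation_ring \<nu>) = (*)" "one (valuation_ring \<nu>) = 1"
  "ring.zero (valuation_ring \<nu>) = 0" "add (valuation_ring \<nu>) = (+)"
  by (simp_all add: valuation_ring_def ring_of_type_algebra_def)

lemma ideal_maximal_ideal:
  assumes a: "nonarchimedean (vabs \<nu>)" and O: "\<And>x. 0 \<le> \<nu> x \<longleftrightarrow> vabs \<nu> x \<le> 1"
    and m: "\<And>x. 0 < \<nu> x \<longleftrightarrow> vabs \<nu> x < 1"
  shows "ideal (maximal_ideal \<nu>) (valuation_ring \<nu>)"
proof -
  interpret nonarchimedean "vabs \<nu>" by (fact a)
  let ?R = "valuation_ring \<nu>"
  note simps = valuation_ring_simps O m maximal_ideal_def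
  have add1: "vabs \<nu> (x + y) \<le> 1" if "vabs \<nu> x \<le> 1" "vabs \<nu> y \<le> 1" for x y
    using ultra[of x y] that by simp
  have add2: "vabs \<nu> (x + y) < 1" if "vabs \<nu> x < 1" "vabs \<nu> y < 1" for x y
    using ultra[of x y] that by simp
  have ab: "abelian_group ?R"
  proof (rule abelian_groupI)
    fix x assume "x \<in> carrier ?R"
    then show "\<exists>y\<in>carrier ?R. y \<oplus>\<^bsub>?R\<^esub> x = \<zero>\<^bsub>?R\<^esub>"
      by (intro bexI[of _ "- x"]) (simp_all add: simps)
  qed (auto simp: simps add1)
  have "monoid ?R" by (rule monoidI) (auto simp: simps mult mult_le_one)
  with ab have R: "ring ?R" by (intro ringI) (auto simp: simps algebra_simps)
  interpret R: ring ?R by (fact R)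
  \<comment> \<open>The inverse in \<open>add_monoid ?R\<close> is given by a description;
    uniqueness identifies it with negation in K.\<close>
  have neg: "inv\<^bsub>add_monoid ?R\<^esub> x = - x" if "vabs \<nu> x \<le> 1" for x
    using R.minus_equality[of "- x" x] that by (simp add: simps a_inv_def)
  show ?thesis
  proof (rule idealI[OF R])
    show "subgroup (maximal_ideal \<nu>) (add_monoid ?R)"
    proof (rule subgroup.intro)
      fix x assume x: "x \<in> maximal_ideal \<nu>"
      then have "vabs \<nu> x \<le> 1" by (simp add: simps)
      then show "inv\<^bsub>add_monoid ?R\<^esub> x \<in> maximal_ideal \<nu>"
        unfolding neg[OF \<open>vabs \<nu> x \<le> 1\<close>] using x by (simp add: simps)
    qed (auto simp: simps add2)
    show "x \<otimes>\<^bsub>?R\<^esub> y \<in> maximal_ideal \<nu>" if "y \<in> maximal_ideal \<nu>" "x \<in> carrier ?R" for x y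
      using that mult_le_one[of "vabs \<nu> x"] mult_left_le_one_le[of "vabs \<nu> y" "vabs \<nu> x"]
      by (auto simp: simps mult)
    show "y \<otimes>\<^bsub>?R\<^esub> x \<in> maximal_ideal \<nu>" if "y \<in> maximal_ideal \<nu>" "x \<in> carrier ?R" for x y
      using that mult_right_le_one_le[of "vabs \<nu> y" "vabs \<nu> x"] by (auto simp: simps mult)
  qed
qed

lemma ex_residue_map:
  fixes \<nu> :: "'k::field \<Rightarrow> int extended"
  assumes \<nu>: "discrete_valuation \<nu>"
    and iso: "residue_field \<nu> \<simeq> (ring_of_type_algebra :: 'f::{field,finite} ring)"
  shows "\<exists>\<rho> :: 'k \<Rightarrow> 'f. residue_map \<nu> \<rho>"
proof -
  let ?L = "ring_of_type_algebra :: 'f ring" and ?R = "valuation_ring \<nu>" and ?I = "maximal_ideal \<nu>"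
  obtain h where "h \<in> ring_iso (residue_field \<nu>) ?L" using iso by (auto simp: is_ring_iso_def)
  then have h: "h \<in> ring_hom (?R Quot ?I) ?L" and bij: "bij_betw h (carrier (?R Quot ?I)) UNIV"
    by (auto simp: ring_iso_def residue_field_def ring_of_type_algebra_simps)
  \<comment> \<open>0 and 1 differ in the field \<open>'f\<close>, and h transports the cardinality,
    so q > 1.\<close>
  have "card {0, 1 :: 'f} \<le> CARD('f)" by (intro card_mono) auto
  then have q: "1 < card (carrier (residue_field \<nu>))"
    using bij_betw_same_card[OF bij] by (simp add: residue_field_def)
  note a = nonarchimedean_vabs[OF \<nu> q]
  interpret nonarchimedean "vabs \<nu>" by (fact a(1))
  interpret I: ideal ?I ?R using a by (intro ideal_maximal_ideal) auto
  let ?\<rho> = "\<lambda>x. h (?I +>\<^bsub>?R\<^esub> x)"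
  note c = ring_hom_memE[OF I.rcos_ring_hom]
  have carr: "x \<in> carrier ?R \<longleftrightarrow> vabs \<nu> x \<le> 1" for x by (simp add: valuation_ring_simps a(2))
  have "residue_map \<nu> ?\<rho>"
  proof
    obtain x where x: "x \<noteq> 0" "\<nu> x \<noteq> 0" using \<nu> by (auto simp: discrete_valuation_def)
    \<comment> \<open>If the absolute value of x exceeds 1, the inverse of x is taken.\<close>
    then consider "vabs \<nu> x < 1" | "1 < vabs \<nu> x" using a(2,3)[of x] by fastforce
    then show "\<exists>x. x \<noteq> 0 \<and> vabs \<nu> x < 1"
    proof cases
      case 2
      then show ?thesis using x by (intro exI[of _ "inverse x"]) (auto simp: inverse intro: inverse_less_1_iff[THEN iffD2])
    qed (use x in blast)
  next
    fix x y assume "vabs \<nu> x \<le> 1" "vabs \<nu> y \<le> 1"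
    then have xy: "x \<in> carrier ?R" "y \<in> carrier ?R" by (simp_all add: carr)
    show "?\<rho> (x + y) = ?\<rho> x + ?\<rho> y"
      using c(3)[OF xy] ring_hom_memE(3)[OF h c(1)[OF xy(1)] c(1)[OF xy(2)]]
      by (simp add: valuation_ring_simps ring_of_type_algebra_simps)
    show "?\<rho> (x * y) = ?\<rho> x * ?\<rho> y"
      using c(2)[OF xy] ring_hom_memE(2)[OF h c(1)[OF xy(1)] c(1)[OF xy(2)]]
      by (simp add: valuation_ring_simps ring_of_type_algebra_simps)
  next
    fix x assume "vabs \<nu> x \<le> 1"
    then have x: "x \<in> carrier ?R" by (simp add: carr)
    have zero: "\<zero>\<^bsub>?R Quot ?I\<^esub> = ?I" by (simp add: FactRing_def)
    have "h ?I = 0"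
      using ring_hom_zero[OF h I.quotient_is_ring ring_from_type_algebra]
      by (simp add: zero ring_of_type_algebra_simps)
    moreover have "?I \<in> carrier (?R Quot ?I)"
      using ring.ring_simprules(2)[OF I.quotient_is_ring] by (simp add: zero)
    \<comment> \<open>As h is injective and sends the zero coset to 0, the kernel consists of the x
      whose coset is the ideal itself.\<close>
    ultimately have "?\<rho> x = 0 \<longleftrightarrow> ?I +>\<^bsub>?R\<^esub> x = ?I"
      using inj_on_eq_iff[OF bij_betw_imp_inj_on[OF bij] c(1)[OF x]] by metis
    also have "\<dots> \<longleftrightarrow> x \<in> ?I" using I.a_rcos_const I.a_rcos_self[OF x] by blast
    also have "\<dots> \<longleftrightarrow> vabs \<nu> x < 1" by (simp add: maximal_ideal_def a(3))
    finally show "?\<rho> x = 0 \<longleftrightarrow> vabs \<nu> x < 1" .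
  next
    fix z :: 'f
    obtain w where w: "w \<in> carrier (?R Quot ?I)" "h w = z"
      using bij by (metis UNIV_I bij_betw_def imageE)
    then obtain x where "x \<in> carrier ?R" "w = ?I +>\<^bsub>?R\<^esub> x" by (auto simp: FactRing_def A_RCOSETS_def')
    then show "\<exists>x. vabs \<nu> x \<le> 1 \<and> ?\<rho> x = z" using w(2) carr by blast
  qed
  then show ?thesis by blast
qed

section \<open>Maximal families\<close>

text \<open>Ensures G \<ge> 1, so that l = 2 meets the condition l - 1 \<le> G.\<close>

lemma Gr_nonempty:
  assumes "s \<le> CARD('n)"
  shows "(Gr s :: ('a::field ^ 'n) set set) \<noteq> {}"
proof -
  obtain A :: "('a ^ 'n) set" where A: "A \<subseteq> cart_basis" "card A = s"
    using assms obtain_subset_with_card_n[of s "cart_basis :: ('a ^ 'n) set"]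
    by (auto simp: card_cart_basis)
  then have "vec.independent A" using independent_cart_basis vec.independent_mono by blast
  then have "vec.dim (vec.span A) = s" using A(2) vec.dim_span_eq_card_independent by blast
  then have "vec.span A \<in> Gr s" unfolding Gr_def using vec.subspace_span by blast
  then show ?thesis by blast
qed

text \<open>Only the version for sets asks for infinite fibres and hence s < n: for s = n the whole
  space is the sole member of Gr s.\<close>

lemma (in residue_map) is_Omega_if_is_maximum:
  fixes n :: "'n::finite itself"
  assumes s: "1 \<le> s" and kl: "2 \<le> l" "l \<le> k"
    and max: "is_maximum {size T | T. admissible (Gr s :: ('f ^ 'n) set set) (k - 1) (l - 1) T} N"
  shows "s < CARD('n) \<Longrightarrow> is_Omega n \<nu> s k l N" and "is_Omega_multi n \<nu> s k l N"
proof -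
  have R: "feebly_orth \<nu> U V \<longleftrightarrow> Red U \<noteq> Red V" if "U \<in> Gr s" "V \<in> Gr s" for U V :: "('k ^ 'n) set"
    using that by (simp add: Gr_def feebly_orth_iff_Red_neq)
  show "is_Omega_multi n \<nu> s k l N"
    unfolding is_Omega_multi_def
    using sizes_of_multifamilies[OF finite Red_Gr R _ kl(2)] kl(1) max by simp
  assume "s < CARD('n)"
  then have inf: "infinite {U \<in> Gr s. Red U = W}" if "W \<in> Gr s" for W :: "('f ^ 'n) set"
    using infinite_Red_fibre[OF that s] by simp
  show "is_Omega n \<nu> s k l N"
    unfolding is_Omega_def
    using sizes_of_families[OF finite Red_Gr R kl inf] max by simp
qed

text \<open>For l - 1 > G there is no index set of size l - 1, so the sums are unbounded, while the
  true maximum is k - 1 and exceeds the asserted upper bound; hence the condition l - 1 \<le> G. For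
  s = n the formula is that of multifamilies, since a family of distinct subspaces has at most one
  member.\<close>

theorem theorem1p12:
  fixes \<nu> :: "'k::field \<Rightarrow> int extended"
    and s k l G :: nat
  assumes "discrete_valuation \<nu>"
    and "residue_field \<nu> \<simeq> (ring_of_type_algebra :: 'f::{field,finite} ring)"
    and "1 \<le> s" and "s \<le> CARD('n::finite)"
    and "2 \<le> l" and "l \<le> k"
    and "G = card (Gr s :: ('f ^ 'n) set set)"
  shows "(\<exists>\<Omega>.
      (s < CARD('n) \<longrightarrow> is_Omega TYPE('n) \<nu> s k l \<Omega>) \<and>
      is_Omega_multi TYPE('n) \<nu> s k l \<Omega> \<and>
      \<lfloor>real (k - 1) / real (l - 1)\<rfloor> * int G \<le> int \<Omega> \<and>
      (l - 1 \<le> G \<longrightarrow>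
         int \<Omega> \<le> \<lfloor>real (k - 1) / real (l - 1) * real G\<rfloor> \<and>
         is_maximum
           {\<Sum>i=1..G. t i | t :: nat \<Rightarrow> nat.
              \<forall>I\<subseteq>{1..G}. card I = l - 1 \<longrightarrow> (\<Sum>i\<in>I. t i) \<le> k - 1} \<Omega> \<and>
         ((l - 1) dvd (k - 1) \<longrightarrow> real \<Omega> = real (k - 1) / real (l - 1) * real G))) \<and>
    (s < CARD('n) \<longrightarrow> is_Omega TYPE('n) \<nu> s k 2 ((k - 1) * G)) \<and>
    is_Omega_multi TYPE('n) \<nu> s k 2 ((k - 1) * G)"
proof -
  let ?Y = "Gr s :: ('f ^ 'n) set set"
  obtain \<rho> :: "'k \<Rightarrow> 'f" where "residue_map \<nu> \<rho>" using ex_residue_map assms(1,2) by blast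
  then interpret residue_map \<nu> \<rho> .
  have l1: "1 \<le> l - 1" using assms(5) by simp
  obtain N where max: "is_maximum {size T | T. admissible ?Y (k - 1) (l - 1) T} N"
    and lower: "(k - 1) div (l - 1) * G \<le> N"
    and upper: "l - 1 \<le> G \<Longrightarrow> (l - 1) * N \<le> (k - 1) * G"
    using maximum_size_of_admissible[of ?Y "l - 1" "k - 1"] l1 assms(7) by auto
  have floor: "\<lfloor>real (k - 1) / real (l - 1)\<rfloor> = int ((k - 1) div (l - 1))"
    by (rule floor_divide_of_nat_eq)
  have le: "real N \<le> real (k - 1) / real (l - 1) * real G" if "l - 1 \<le> G"
  proof -
    have "real (l - 1) * real N \<le> real (k - 1) * real G" using upper[OF that] by (metis of_nat_le_iff of_nat_mult)
    then show ?thesis using l1 by (simp add: field_simps)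
  qed
  have eq: "real N = real (k - 1) / real (l - 1) * real G" if "l - 1 \<le> G" and dvd: "(l - 1) dvd (k - 1)"
  \<comment> \<open>Under divisibility the floor is exact and the lower bound meets the upper
    one.\<close>
  proof (rule antisym[OF le[OF that(1)]])
    have "real ((k - 1) div (l - 1) * G) \<le> real N" using lower by (rule of_nat_mono)
    then show "real (k - 1) / real (l - 1) * real G \<le> real N"
      using dvd by (simp only: of_nat_mult real_of_nat_div)
  qed
  have sums: "is_maximum {\<Sum>i=1..G. t i | t :: nat \<Rightarrow> nat.
      \<forall>I\<subseteq>{1..G}. card I = l - 1 \<longrightarrow> (\<Sum>i\<in>I. t i) \<le> k - 1} N" if "l - 1 \<le> G"
    using max sizes_of_admissible[of ?Y "l - 1" "k - 1"] that by (simp add: assms(7))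
  have bound: "int N \<le> \<lfloor>real (k - 1) / real (l - 1) * real G\<rfloor>" if "l - 1 \<le> G"
    using le[OF that] by (simp add: le_floor_iff)
  have lower': "\<lfloor>real (k - 1) / real (l - 1)\<rfloor> * int G \<le> int N"
    unfolding floor using lower by (metis of_nat_le_iff of_nat_mult)
  \<comment> \<open>The case l = 2, where both bounds coincide; \<open>2 - 1\<close> matches the
    shape \<open>l - 1\<close>.\<close>
  obtain M where M: "is_maximum {size T | T. admissible ?Y (k - 1) (2 - 1) T} M"
    and "(k - 1) * G \<le> M" "1 \<le> G \<Longrightarrow> M \<le> (k - 1) * G"
    using maximum_size_of_admissible[of ?Y "2 - 1" "k - 1"] assms(7) by auto
  moreover have "1 \<le> G"
    using Gr_nonempty[OF assms(4), where 'a = 'f] by (simp add: assms(7) card_gt_0_iff Suc_le_eq)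
  ultimately have "M = (k - 1) * G" by simp
  have "2 \<le> k" using assms by simp
  from is_Omega_if_is_maximum[OF assms(3) order_refl this M, of "TYPE('n)"] \<open>M = (k - 1) * G\<close>
  have two: "(s < CARD('n) \<longrightarrow> is_Omega TYPE('n) \<nu> s k 2 ((k - 1) * G)) \<and>
    is_Omega_multi TYPE('n) \<nu> s k 2 ((k - 1) * G)" by simp
  show ?thesis
  proof (intro conjI exI[of _ N] impI)
    show "is_Omega TYPE('n) \<nu> s k l N" if "s < CARD('n)"
      using is_Omega_if_is_maximum(1)[OF assms(3,5,6) max that] .
    show "is_Omega_multi TYPE('n) \<nu> s k l N" using is_Omega_if_is_maximum(2)[OF assms(3,5,6) max] .
  qed (use two lower' bound sums eq in blast)+
qed

end
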